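(* Let $F_\tau$ be the Gromov boundary of a supercritical Galton-Watson tree with bounded offspring distribution. Let $\phi$ be a dimension function such that $\phi(x)=\omega\big(\log|\log x|/|\log x|\big)$, i.e. $$\frac{\log|\log x|/|\log x|}{\phi(x)}\to 0\quad\text{as }x\to0 .$$ Then, conditioned on non-extinction, almost surely $$\dim_{\mathrm A}^{\phi}F_\tau=\dim_{\mathrm B}F_\tau=\dim_{\mathrm H}F_\tau .$$
   Context: Dimension function: a function $\phi$ with values in $(0,\infty)$ such that $x\mapsto\phi(x)$ and $x\mapsto\phi(x)|\log x|$ are both monotone on $(0,1)$. Generalised Assouad spectrum: for a metric space $F$ let $N_r(E)$ be the minimal number of balls of radius at most $r$ needed to cover $E$, and let $B(x,R)$ be the ball of radius $R$ centred at $x$. For a dimension function $\phi$, $\dim_{\mathrm A}^{\phi}F$ is the infimum of all $s$ for which there is $C>0$ such that for all $0<R<1$, with $r=R^{1+\phi(R)}$, one has $\sup_{x\in F}N_r(F\cap B(x,R))\le C(R/r)^s=C R^{-\phi(R)s}$. Galton-Watson tree: $X$ is a random variable taking values in $\{0,1,\dots,N\}$ for some integer $N$, with $\theta_j=\mathbb{P}\{X=j\}$. Starting from a single root, every node is given a random number of children with the law of $X$, independently of all other nodes. The process is supercritical: $m=\mathbb{E}(X)=\sum_{k}k\,\theta_k>1$. We condition on non-extinction, i.e. on the tree being infinite. The Gromov boundary $F_\tau$ is the set of infinite descending paths starting at the root, with metric $d(x,y)=2^{-|x\wedge y|}$, where $|x\wedge y|$ is the level of the least common ancestor (last common node) of $x$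 and $y$. $\dim_{\mathrm B}$ and $\dim_{\mathrm H}$ are the box-counting and Hausdorff dimensions; it is known that almost surely (conditioned on non-extinction) $\dim_{\mathrm B}F_\tau=\dim_{\mathrm H}F_\tau=\log m/\log 2$. *)

theory Defs
  imports "HOL-Probability.Probability"
begin

section \<open>Dimensions of metric spaces\<close>

text \<open>Balls are closed and have their centres in the space. An infimum over the empty set is
  \<open>\<infinity>\<close>, so a set without a finite cover has covering number \<open>\<infinity>\<close>.\<close>

definition covering_number :: "'a metric \<Rightarrow> real \<Rightarrow> 'a set \<Rightarrow> enat" where
  "covering_number m r E =
     (INF \<B> \<in> {\<B>. finite \<B> \<and> \<B> \<subseteq> {mcball_of m x \<rho> | x \<rho>. x \<in> mspace m \<and> 0 < \<rho> \<and> \<rho> \<le> r} \<and> E \<subseteq> \<Union>\<B>}.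
        enat (card \<B>))"

definition dimension_function :: "(real \<Rightarrow> real) \<Rightarrow> bool" where
  "dimension_function \<phi> \<longleftrightarrow>
     (\<forall>x\<in>{0<..<1}. 0 < \<phi> x) \<and>
     (mono_on {0<..<1} \<phi> \<or> antimono_on {0<..<1} \<phi>) \<and>
     (mono_on {0<..<1} (\<lambda>x. \<phi> x * \<bar>ln x\<bar>) \<or> antimono_on {0<..<1} (\<lambda>x. \<phi> x * \<bar>ln x\<bar>))"

definition assouad_dim :: "(real \<Rightarrow> real) \<Rightarrow> 'a metric \<Rightarrow> ereal" where
  "assouad_dim \<phi> m =
     (INF s \<in> {s. \<exists>C>0. \<forall>R. 0 < R \<and> R < 1 \<longrightarrow>
                 (let r = R powr (1 + \<phi> R) in
                   ereal_of_enat (SUP x\<in>mspace m. covering_number m r (mcball_of m x R))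
                     \<le> ereal (C * (R / r) powr s))}.
        ereal s)"

definition ln_enat :: "enat \<Rightarrow> ereal" where
  "ln_enat n = (case n of enat k \<Rightarrow> if k = 0 then - \<infinity> else ereal (ln (real k)) | \<infinity> \<Rightarrow> \<infinity>)"

definition lower_box_dim :: "'a metric \<Rightarrow> ereal" where
  "lower_box_dim m =
     Liminf (at_right 0) (\<lambda>r. ln_enat (covering_number m r (mspace m)) / ereal (- ln r))"

definition upper_box_dim :: "'a metric \<Rightarrow> ereal" where
  "upper_box_dim m =
     Limsup (at_right 0) (\<lambda>r. ln_enat (covering_number m r (mspace m)) / ereal (- ln r))"

text \<open>The box-counting dimension need not exist; this says that it does and has value \<open>D\<close>.\<close>

definition has_box_dim :: "'a metric \<Rightarrow> ereal \<Rightarrow> bool" where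
  "has_box_dim m D \<longleftrightarrow> lower_box_dim m = D \<and> upper_box_dim m = D"

definition mdiameter :: "'a metric \<Rightarrow> 'a set \<Rightarrow> ennreal" where
  "mdiameter m U = (SUP x\<in>U. SUP y\<in>U. ennreal (mdist m x y))"

definition hausdorff_premeasure :: "'a metric \<Rightarrow> real \<Rightarrow> real \<Rightarrow> 'a set \<Rightarrow> ennreal" where
  "hausdorff_premeasure m s \<delta> E =
     (INF U \<in> {U :: nat \<Rightarrow> 'a set. (\<forall>i. U i \<subseteq> mspace m \<and> mdiameter m (U i) \<le> ennreal \<delta>) \<and> E \<subseteq> (\<Union>i. U i)}.
        \<Sum>i. ennreal (enn2real (mdiameter m (U i)) powr s))"

definition hausdorff_measure :: "'a metric \<Rightarrow> real \<Rightarrow> 'a set \<Rightarrow> ennreal" where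
  "hausdorff_measure m s E = (SUP \<delta>\<in>{0<..}. hausdorff_premeasure m s \<delta> E)"

text \<open>The exponent \<open>0\<close> is left out because \<open>0 powr 0 = 0\<close> would give singletons measure \<open>0\<close> (and
  not \<open>1\<close>). The infimum is not affected: a set of measure \<open>0\<close> for the counting measure is empty.\<close>

definition hausdorff_dim :: "'a metric \<Rightarrow> ereal" where
  "hausdorff_dim m = (INF s \<in> {s. 0 < s \<and> hausdorff_measure m s (mspace m) = 0}. ereal s)"


section \<open>Trees and their Gromov boundary\<close>

text \<open>A node is addressed by the list of child positions leading to it from the root \<open>[]\<close>;
  \<open>c v\<close> is the number of children of \<open>v\<close>. The values of \<open>c\<close> outside the tree play no role.\<close>

inductive_set tree :: "(nat list \<Rightarrow> nat) \<Rightarrow> nat list set" for c :: "nat list \<Rightarrow> nat" where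
  root: "[] \<in> tree c"
| child: "v \<in> tree c \<Longrightarrow> i < c v \<Longrightarrow> v @ [i] \<in> tree c"

definition rays :: "nat list set \<Rightarrow> (nat \<Rightarrow> nat list) set" where
  "rays T = {x. x 0 = [] \<and> (\<forall>n. x n \<in> T \<and> (\<exists>i. x (Suc n) = x n @ [i]))}"

text \<open>The level of the last common node of two distinct rays.\<close>

definition meet_level :: "(nat \<Rightarrow> nat list) \<Rightarrow> (nat \<Rightarrow> nat list) \<Rightarrow> nat" where
  "meet_level x y = (GREATEST n. x n = y n)"

definition ray_dist :: "(nat \<Rightarrow> nat list) \<Rightarrow> (nat \<Rightarrow> nat list) \<Rightarrow> real" where
  "ray_dist x y = (if x = y then 0 else 2 powr (- real (meet_level x y)))"

definition gromov_boundary :: "nat list set \<Rightarrow> (nat \<Rightarrow> nat list) metric" where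
  "gromov_boundary T = metric (rays T, ray_dist)"

lemma rays_agree_below:
  assumes x: "x \<in> rays T" and y: "y \<in> rays T" and "x n = y n" "k \<le> n"
  shows "x k = y k"
  using assms(4,3)
proof (induction rule: inc_induct)
  case base then show ?case .
next
  case (step n)
  obtain i j where "x (Suc n) = x n @ [i]" "y (Suc n) = y n @ [j]"
    using x y unfolding rays_def by blast
  with step show ?case by simp
qed

lemma rays_agree_iff:
  assumes x: "x \<in> rays T" and y: "y \<in> rays T" and "x \<noteq> y"
  shows "x n = y n \<longleftrightarrow> n \<le> meet_level x y"
proof -
  obtain b where b: "x b \<noteq> y b" using assms by blast
  have bd: "\<And>k. x k = y k \<Longrightarrow> k \<le> b"
    using rays_agree_below[OF x y] b by (meson nat_le_linear)
  have "x 0 = y 0" using x y by (simp add: rays_def)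
  then have "x (meet_level x y) = y (meet_level x y)"
    unfolding meet_level_def using bd by (rule GreatestI_nat)
  moreover have "x n = y n \<Longrightarrow> n \<le> meet_level x y"
    unfolding meet_level_def using bd by (auto intro: Greatest_le_nat)
  ultimately show ?thesis using rays_agree_below[OF x y] by blast
qed

lemma Metric_space_rays: "Metric_space (rays T) ray_dist"
proof
  show "0 \<le> ray_dist x y" for x y by (simp add: ray_dist_def)
  show "ray_dist x y = ray_dist y x" for x y
    by (simp add: ray_dist_def meet_level_def eq_commute)
  show "ray_dist x y = 0 \<longleftrightarrow> x = y" for x y by (simp add: ray_dist_def)
  show "ray_dist x z \<le> ray_dist x y + ray_dist y z"
    if m: "x \<in> rays T" "y \<in> rays T" "z \<in> rays T" for x y z
  proof (cases "x = y \<or> y = z \<or> x = z")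
    case True
    then show ?thesis by (auto simp: ray_dist_def)
  next
    case False
    let ?k = "min (meet_level x y) (meet_level y z)"
    have "x ?k = z ?k"
      using rays_agree_iff[OF m(1,2), of ?k] rays_agree_iff[OF m(2,3), of ?k] False by simp
    then have "?k \<le> meet_level x z"
      using rays_agree_iff[OF m(1,3)] False by blast
    then have "ray_dist x z \<le> 2 powr (- real ?k)"
      using False by (simp add: ray_dist_def)
    also have "\<dots> \<le> ray_dist x y + ray_dist y z"
      using False by (auto simp: ray_dist_def min_def)
    finally show ?thesis .
  qed
qed

lemma mspace_gromov_boundary [simp]: "mspace (gromov_boundary T) = rays T"
  and mdist_gromov_boundary [simp]: "mdist (gromov_boundary T) = ray_dist"
  unfolding gromov_boundary_def
  by (simp_all add: Metric_space.mspace_metric Metric_space.mdist_metric Metric_space_rays)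

end

theory Submission
  imports Defs "HOL-Real_Asymp.Real_Asymp"
begin

text \<open>All dimensions equal \<open>log 2 m\<close>.

  Upper bounds. Iterating the generating function \<open>f\<close> of \<open>\<theta>\<close> near its fixed point \<open>1\<close> bounds an
  exponential moment of \<open>Z\<^sub>n / a\<^sup>n\<close> for \<open>a > m\<close>, hence \<open>P(Z\<^sub>n > b\<^sup>n)\<close> is doubly exponentially small
  for \<open>b > a\<close>. There are at most \<open>N\<^sup>k\<close> nodes of level \<open>k\<close>, so by Borel-Cantelli almost surely,
  for large \<open>n\<close>, all nodes of level at most \<open>\<gamma>\<^sup>n\<close> have at most \<open>b\<^sup>n\<close> descendants \<open>n\<close> generations
  later. The growth condition on \<open>\<phi>\<close> says that the levels \<open>k\<close> and \<open>k + n\<close> of the scales \<open>R\<close> and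
  \<open>R powr (1 + \<phi> R)\<close> satisfy \<open>k \<le> \<gamma>\<^sup>n\<close>.

  Lower bounds. Let \<open>p > 1 / m\<close>. Percolation on the tree with edge probability \<open>p\<close> is a supercritical
  Galton-Watson process, so its survival probability \<open>q\<close> given the tree is positive with positive
  probability. Both \<open>q = 0\<close> and extinction have a probability that is a fixed point of \<open>f\<close> in
  \<open>[0, 1)\<close>, where \<open>f\<close> has only one; so \<open>q > 0\<close> almost surely on non-extinction. By a union bound, nodes \<open>v\<close>
  that block all rays satisfy \<open>q \<le> \<Sum>v. p ^ length v\<close>, which bounds the size of every cover.\<close>

section \<open>The Galton-Watson measure\<close>

text \<open>The offspring numbers seen from \<open>v\<close>: re-rooting a tree at \<open>v\<close>
  amounts to prefixing every address with \<open>v\<close>.\<close>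

definition shift :: "'a list \<Rightarrow> ('a list \<Rightarrow> 'b) \<Rightarrow> 'a list \<Rightarrow> 'b" where
  "shift v c = (\<lambda>u. c (v @ u))"

lemma shift_Nil [simp]: "shift [] c = c"
  and shift_shift: "shift w (shift v c) = shift (v @ w) c"
  and shift_at_Nil [simp]: "shift v c [] = c v"
  by (simp_all add: shift_def)

text \<open>Every address gets an offspring number, also those outside the tree. This product space
  makes \<open>shift v\<close> measure preserving with no conditioning on \<open>v\<close> being a
  node.\<close>

definition gw :: "nat pmf \<Rightarrow> (nat list \<Rightarrow> nat) measure" where
  "gw \<theta> = PiM UNIV (\<lambda>_. measure_pmf \<theta>)"

lemma prob_space_gw: "prob_space (gw \<theta>)"
  unfolding gw_def by (intro prob_space_PiM prob_space_measure_pmf)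

interpretation gw: prob_space "gw \<theta>" for \<theta>
  by (rule prob_space_gw)

lemma space_gw [simp]: "space (gw \<theta>) = UNIV"
  by (simp add: gw_def space_PiM)

lemma UNIV_in_sets_gw [simp]: "UNIV \<in> sets (gw \<theta>)"
  using sets.top[of "gw \<theta>"] by simp

lemma sets_gw: "sets (gw \<theta>) = sets (PiM UNIV (\<lambda>_. count_space UNIV))"
  unfolding gw_def by (rule sets_PiM_cong) auto

lemma measurable_gw_component [measurable]: "(\<lambda>c. c v) \<in> gw \<theta> \<rightarrow>\<^sub>M count_space UNIV"
proof -
  have "(\<lambda>c. c v) \<in> PiM UNIV (\<lambda>_. measure_pmf \<theta>) \<rightarrow>\<^sub>M measure_pmf \<theta>"
    by (rule measurable_component_singleton) simp
  then show ?thesis by (simp add: gw_def)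
qed

lemma measurable_shift [measurable]: "shift v \<in> gw \<theta> \<rightarrow>\<^sub>M gw \<theta>"
  unfolding shift_def gw_def
  by (rule measurable_PiM_single') (auto intro!: measurable_gw_component[unfolded gw_def] simp: space_PiM)

text \<open>Prefixing with \<open>v\<close> is injective on addresses, so re-rooting selects a
  subfamily of i.i.d. coordinates.\<close>

lemma distr_shift: "distr (gw \<theta>) (gw \<theta>) (shift v) = gw \<theta>"
proof -
  have "distr (PiM UNIV (\<lambda>_. measure_pmf \<theta>)) (\<Pi>\<^sub>M u\<in>UNIV. measure_pmf \<theta>) (\<lambda>c. \<lambda>u\<in>UNIV. c (v @ u)) = (\<Pi>\<^sub>M u\<in>UNIV. measure_pmf \<theta>)"
    by (rule distr_PiM_reindex) (auto simp: prob_space_measure_pmf inj_on_def)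
  then show ?thesis by (simp add: gw_def shift_def[abs_def] restrict_def)
qed

lemma nn_integral_shift:
  assumes [measurable]: "h \<in> borel_measurable (gw \<theta>)"
  shows "(\<integral>\<^sup>+c. h (shift v c) \<partial>gw \<theta>) = (\<integral>\<^sup>+c. h c \<partial>gw \<theta>)"
  using nn_integral_distr[of "shift v" "gw \<theta>" "gw \<theta>" h] by (simp add: distr_shift)

lemma emeasure_component: "emeasure (gw \<theta>) {c. c v = k} = ennreal (pmf \<theta> k)"
proof -
  have "emeasure (measure_pmf \<theta>) {k} = emeasure (distr (gw \<theta>) (measure_pmf \<theta>) (\<lambda>c. c v)) {k}"
    unfolding gw_def by (subst distr_PiM_component) (auto simp: prob_space_measure_pmf)
  also have "\<dots> = emeasure (gw \<theta>) {c. c v = k}"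
    by (subst emeasure_distr) (auto simp: vimage_def)
  finally show ?thesis by (simp add: emeasure_pmf_single)
qed

lemma indep_vars_gw_component: "gw.indep_vars \<theta> (\<lambda>_. count_space UNIV) (\<lambda>v c. c v) UNIV"
proof (subst gw.indep_vars_iff_distr_eq_PiM')
  show "distr (gw \<theta>) (Pi\<^sub>M UNIV (\<lambda>i. count_space UNIV)) (\<lambda>x. \<lambda>i\<in>UNIV. x i) =
        Pi\<^sub>M UNIV (\<lambda>i. distr (gw \<theta>) (count_space UNIV) (\<lambda>c. c i))" (is "?l = ?r")
  proof -
    have "distr (gw \<theta>) (count_space UNIV) (\<lambda>c. c i) = measure_pmf \<theta>" for i
    proof -
      have "distr (gw \<theta>) (count_space UNIV) (\<lambda>c. c i) = distr (gw \<theta>) (measure_pmf \<theta>) (\<lambda>c. c i)"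
        by (rule distr_cong) auto
      also have "\<dots> = measure_pmf \<theta>"
        unfolding gw_def by (rule distr_PiM_component) (auto simp: prob_space_measure_pmf)
      finally show ?thesis .
    qed
    then have "?r = gw \<theta>" by (simp add: gw_def)
    moreover have "?l = gw \<theta>" by (simp add: distr_id2 sets_gw restrict_def)
    ultimately show ?thesis by simp
  qed
qed auto

section \<open>Generating function and branching property\<close>

definition genfun :: "nat pmf \<Rightarrow> nat \<Rightarrow> real \<Rightarrow> real" where
  "genfun \<theta> N x = (\<Sum>k\<le>N. pmf \<theta> k * x ^ k)"

text \<open>The number of factors is random; the product is measurable on each of the countably many
  events that fix it.\<close>

lemma measurable_prod_children [measurable]:
  fixes g :: "(nat list \<Rightarrow> nat) \<Rightarrow> real"
  assumes [measurable]: "g \<in> borel_measurable (gw \<theta>)"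
  shows "(\<lambda>c. \<Prod>i<c []. g (shift [i] c)) \<in> borel_measurable (gw \<theta>)"
  by (rule measurable_compose_countable[where f = "\<lambda>k c. \<Prod>i<k. g (shift [i] c)" and g = "\<lambda>c. c []"])
    measurable

text \<open>Branching property: the root and the subtrees at its first \<open>k\<close> children
  depend on disjoint sets of addresses, hence are independent, and the expectation
  factorises.\<close>

lemma nn_integral_children_eq:
  fixes g :: "(nat list \<Rightarrow> nat) \<Rightarrow> ennreal"
  assumes [measurable]: "g \<in> borel_measurable (gw \<theta>)"
  shows "(\<integral>\<^sup>+c. indicator {c. c [] = k} c * (\<Prod>i<k. g (shift [i] c)) \<partial>gw \<theta>)
         = ennreal (pmf \<theta> k) * (\<integral>\<^sup>+c. g c \<partial>gw \<theta>) ^ k"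
proof -
  \<comment> \<open>Block \<open>0\<close> holds the root address, block \<open>Suc i\<close> the
    addresses starting with \<open>i\<close>; \<open>Y j\<close> is the factor that reads only block
    \<open>j\<close>.\<close>
  define K :: "nat \<Rightarrow> nat list set" where "K j = (case j of 0 \<Rightarrow> {[]} | Suc i \<Rightarrow> range ((#) i))" for j
  define Y where "Y j c = (case j of 0 \<Rightarrow> indicator {k} (c [])
                             | Suc i \<Rightarrow> g (\<lambda>u. c (i # u)))" for j and c :: "nat list \<Rightarrow> nat"
  have "disjoint_family_on K {..k}"
    by (auto simp: disjoint_family_on_def K_def split: nat.splits)
  then have "gw.indep_vars \<theta> (\<lambda>j. PiM (K j) (\<lambda>_. count_space UNIV))
               (\<lambda>j c. restrict (\<lambda>v. c v) (K j)) {..k}"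
    by (intro gw.indep_vars_restrict[OF indep_vars_gw_component]) auto
  then have "gw.indep_vars \<theta> (\<lambda>_. borel) (\<lambda>j c. Y j (restrict (\<lambda>v. c v) (K j))) {..k}"
  proof (rule gw.indep_vars_compose2)
    fix j
    show "Y j \<in> borel_measurable (PiM (K j) (\<lambda>_. count_space UNIV))"
    proof (cases j)
      case 0
      have "(\<lambda>c. c []) \<in> PiM (K j) (\<lambda>_. count_space UNIV) \<rightarrow>\<^sub>M (count_space UNIV :: nat measure)"
        by (rule measurable_component_singleton) (simp add: K_def 0)
      from measurable_compose[OF this, of "indicator {k} :: nat \<Rightarrow> ennreal" borel]
      show ?thesis by (simp add: Y_def[abs_def] 0)
    next
      case (Suc i)
      have "(\<lambda>c u. c (i # u)) \<in> PiM (K j) (\<lambda>_. count_space UNIV) \<rightarrow>\<^sub>M (gw \<theta>)"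
        unfolding gw_def
      proof (rule measurable_PiM_single')
        fix u
        have "(\<lambda>c. c (i # u)) \<in> PiM (K j) (\<lambda>_. count_space UNIV) \<rightarrow>\<^sub>M (count_space UNIV :: nat measure)"
          by (rule measurable_component_singleton) (simp add: K_def Suc)
        then show "(\<lambda>c. c (i # u)) \<in> PiM (K j) (\<lambda>_. count_space UNIV) \<rightarrow>\<^sub>M measure_pmf \<theta>" by simp
      qed auto
      from measurable_compose[OF this assms] show ?thesis by (simp add: Y_def[abs_def] Suc)
    qed
  qed
  then have "(\<integral>\<^sup>+c. (\<Prod>j\<in>{..k}. Y j (restrict (\<lambda>v. c v) (K j))) \<partial>gw \<theta>)
     = (\<Prod>j\<in>{..k}. \<integral>\<^sup>+c. Y j (restrict (\<lambda>v. c v) (K j)) \<partial>gw \<theta>)"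
    by (intro gw.indep_vars_nn_integral) auto
  moreover have "Y j (restrict (\<lambda>v. c v) (K j)) = Y j c" for j c
    by (cases j) (auto simp: Y_def K_def)
  ultimately have *: "(\<integral>\<^sup>+c. (\<Prod>j\<le>k. Y j c) \<partial>gw \<theta>) = (\<Prod>j\<le>k. \<integral>\<^sup>+c. Y j c \<partial>gw \<theta>)"
    by simp
  have "(\<Prod>j\<le>k. Y j c) = indicator {c. c [] = k} c * (\<Prod>i<k. g (shift [i] c))" for c
    by (subst lessThan_Suc_atMost[symmetric], subst prod.lessThan_Suc_shift)
      (simp add: Y_def shift_def indicator_def)
  moreover have "(\<Prod>j\<le>k. \<integral>\<^sup>+c. Y j c \<partial>gw \<theta>) = ennreal (pmf \<theta> k) * (\<integral>\<^sup>+c. g c \<partial>gw \<theta>) ^ k"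
  proof -
    have "(\<integral>\<^sup>+c. Y 0 c \<partial>gw \<theta>) = (\<integral>\<^sup>+c. indicator {c. c [] = k} c \<partial>gw \<theta>)"
      by (intro nn_integral_cong) (auto simp: Y_def indicator_def)
    also have "\<dots> = ennreal (pmf \<theta> k)"
    proof -
      have "{c \<in> space (gw \<theta>). c [] = k} \<in> sets (gw \<theta>)" by measurable
      then show ?thesis by (simp add: emeasure_component)
    qed
    finally have 0: "(\<integral>\<^sup>+c. Y 0 c \<partial>gw \<theta>) = ennreal (pmf \<theta> k)" .
    have S: "(\<integral>\<^sup>+c. Y (Suc i) c \<partial>gw \<theta>) = (\<integral>\<^sup>+c. g c \<partial>gw \<theta>)" for i
      using nn_integral_shift[OF assms, of "[i]"] by (simp add: Y_def shift_def)
    show ?thesis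
      by (subst lessThan_Suc_atMost[symmetric], subst prod.lessThan_Suc_shift) (simp add: 0 S)
  qed
  ultimately show ?thesis using * by simp
qed

text \<open>Conditioned on \<open>k\<close> children the product has mean \<open>a ^ k\<close>;
  averaging over \<open>k\<close> gives the generating function at \<open>a\<close>. This turns
  recursions over subtrees into iterations of \<open>genfun\<close>.\<close>

lemma nn_integral_children:
  fixes g :: "(nat list \<Rightarrow> nat) \<Rightarrow> real"
  assumes \<theta>: "set_pmf \<theta> \<subseteq> {0..N}"
    and g [measurable]: "g \<in> borel_measurable (gw \<theta>)" and nonneg: "\<And>c. 0 \<le> g c"
    and a: "(\<integral>\<^sup>+c. ennreal (g c) \<partial>gw \<theta>) = ennreal a" "0 \<le> a"
  shows "(\<integral>\<^sup>+c. ennreal (\<Prod>i<c []. g (shift [i] c)) \<partial>gw \<theta>) = ennreal (genfun \<theta> N a)"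
proof -
  have "(\<integral>\<^sup>+c. ennreal (\<Prod>i<c []. g (shift [i] c)) \<partial>gw \<theta>)
      = (\<integral>\<^sup>+c. (\<Sum>k. indicator {c. c [] = k} c * (\<Prod>i<k. ennreal (g (shift [i] c)))) \<partial>gw \<theta>)"
  proof (rule nn_integral_cong)
    fix c
    have "(\<Sum>k. indicator {c. c [] = k} c * (\<Prod>i<k. ennreal (g (shift [i] c))))
        = (\<Sum>k\<in>{c []}. indicator {c. c [] = k} c * (\<Prod>i<k. ennreal (g (shift [i] c))))"
      by (rule suminf_finite) (auto simp: indicator_def)
    then show "ennreal (\<Prod>i<c []. g (shift [i] c))
        = (\<Sum>k. indicator {c. c [] = k} c * (\<Prod>i<k. ennreal (g (shift [i] c))))"
      by (simp add: prod_ennreal nonneg)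
  qed
  also have "\<dots> = (\<Sum>k. \<integral>\<^sup>+c. indicator {c. c [] = k} c * (\<Prod>i<k. ennreal (g (shift [i] c))) \<partial>gw \<theta>)"
    by (rule nn_integral_suminf) measurable
  also have "\<dots> = (\<Sum>k. ennreal (pmf \<theta> k) * ennreal a ^ k)"
    by (subst nn_integral_children_eq) (simp_all add: a)
  also have "\<dots> = (\<Sum>k\<le>N. ennreal (pmf \<theta> k) * ennreal a ^ k)"
  proof (rule suminf_finite)
    fix k assume "k \<notin> {..N}"
    with \<theta> have "pmf \<theta> k = 0" by (auto simp: pmf_eq_0_set_pmf)
    then show "ennreal (pmf \<theta> k) * ennreal a ^ k = 0" by simp
  qed auto
  also have "\<dots> = ennreal (genfun \<theta> N a)"
    using a by (simp add: genfun_def ennreal_power ennreal_mult[symmetric] sum_ennreal)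
  finally show ?thesis .
qed

section \<open>Sizes of generations\<close>

lemma Nil_in_tree [simp]: "[] \<in> tree c"
  by (rule tree.root)

lemma tree_snoc_iff: "v @ [i] \<in> tree c \<longleftrightarrow> v \<in> tree c \<and> i < c v"
  by (auto intro: tree.child elim: tree.cases)

lemma tree_append_iff: "v @ u \<in> tree c \<longleftrightarrow> v \<in> tree c \<and> u \<in> tree (shift v c)"
proof (induction u rule: rev_induct)
  case (snoc i u)
  have "v @ u @ [i] \<in> tree c \<longleftrightarrow> v @ u \<in> tree c \<and> i < c (v @ u)"
    using tree_snoc_iff[of "v @ u" i c] by simp
  with snoc show ?case by (auto simp: tree_snoc_iff shift_def)
qed simp

lemma tree_Cons_iff: "i # u \<in> tree c \<longleftrightarrow> i < c [] \<and> u \<in> tree (shift [i] c)"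
  using tree_append_iff[of "[i]" u c] tree_snoc_iff[of "[]" i c] by simp

text \<open>The size of the \<open>n\<close>-th generation, computed through the subtrees of the
  root rather than from one level to the next, so that the branching property applies
  directly.\<close>

primrec generation :: "nat \<Rightarrow> (nat list \<Rightarrow> nat) \<Rightarrow> nat" where
  "generation 0 c = 1"
| "generation (Suc n) c = (\<Sum>i<c []. generation n (shift [i] c))"

lemma card_generation:
  "finite {u \<in> tree c. length u = n} \<and> card {u \<in> tree c. length u = n} = generation n c"
proof (induction n arbitrary: c)
  case 0
  have "{u \<in> tree c. length u = 0} = {[]}" by auto
  then show ?case by simp
next
  case (Suc n)
  let ?L = "\<lambda>i. (#) i ` {u \<in> tree (shift [i] c). length u = n}"
  have eq: "{u \<in> tree c. length u = Suc n} = (\<Union>i<c []. ?L i)"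
    by (auto simp: length_Suc_conv tree_Cons_iff image_iff)
  have "card (\<Union>i<c []. ?L i) = (\<Sum>i<c []. card (?L i))"
    using Suc by (intro card_UN_disjoint) auto
  then show ?case
    unfolding eq using Suc by (auto simp: card_image inj_on_def)
qed

lemma measurable_generation [measurable]: "generation n \<in> gw \<theta> \<rightarrow>\<^sub>M count_space UNIV"
proof (induction n)
  case (Suc n)
  note [measurable] = Suc
  have *: "(\<lambda>c. \<Sum>i<k. generation n (shift [i] c)) \<in> gw \<theta> \<rightarrow>\<^sub>M count_space UNIV" for k
    by (induction k) simp_all
  have "(\<lambda>c. \<Sum>i<c []. generation n (shift [i] c)) \<in> gw \<theta> \<rightarrow>\<^sub>M count_space UNIV"
    by (rule measurable_compose_countable[where f = "\<lambda>k c. \<Sum>i<k. generation n (shift [i] c)" and g = "\<lambda>c. c []"])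
      (auto simp: *)
  then show ?case by simp
qed simp

text \<open>All levels are finite, and an empty level stays empty because prefixes of nodes are
  nodes.\<close>

lemma tree_finite_iff: "finite (tree c) \<longleftrightarrow> (\<exists>n. generation n c = 0)"
proof
  assume fin: "finite (tree c)"
  then obtain n where "\<forall>k\<in>length ` tree c. k < n"
    using finite_nat_bounded[of "length ` tree c"] by auto
  then have "{u \<in> tree c. length u = n} = {}" by auto
  then show "\<exists>n. generation n c = 0" using card_generation[of c n] by (intro exI[of _ n]) (metis card.empty)
next
  assume "\<exists>n. generation n c = 0"
  then obtain n where "{u \<in> tree c. length u = n} = {}" using card_generation[of c] by (metis card_0_eq)
  moreover have "take n u \<in> tree c" if "u \<in> tree c" for u
    using that tree_append_iff[of "take n u" "drop n u" c] by simp
  ultimately have "length u < n" if "u \<in> tree c" for u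
    using that by (metis (mono_tags, lifting) empty_Collect_eq length_take min.absorb2 not_less)
  then have "tree c \<subseteq> (\<Union>k<n. {u \<in> tree c. length u = k})" by auto
  then show "finite (tree c)" by (rule finite_subset) (use card_generation in auto)
qed

section \<open>Iterates of the generating function and tails of generation sizes\<close>

lemma genfun_1 : "set_pmf \<theta> \<subseteq> {0..N} \<Longrightarrow> genfun \<theta> N 1 = 1"
  unfolding genfun_def using sum_pmf_eq_1[of "{..N}" \<theta>] by (simp add: atMost_atLeast0)

lemma genfun_nonneg: "0 \<le> x \<Longrightarrow> 0 \<le> genfun \<theta> N x"
  unfolding genfun_def by (intro sum_nonneg mult_nonneg_nonneg) auto

lemma genfun_mono: "0 \<le> x \<Longrightarrow> x \<le> y \<Longrightarrow> genfun \<theta> N x \<le> genfun \<theta> N y"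
  unfolding genfun_def by (intro sum_mono mult_left_mono power_mono) auto

lemma funpow_genfun_nonneg: "0 \<le> x \<Longrightarrow> 0 \<le> (genfun \<theta> N ^^ n) x"
  by (induction n) (auto intro: genfun_nonneg)

locale supercritical =
  fixes \<theta> :: "nat pmf" and N :: nat and m :: real
  assumes bounded: "set_pmf \<theta> \<subseteq> {0..N}"
  defines "m \<equiv> measure_pmf.expectation \<theta> real"
  assumes m_gt_1: "1 < m"
begin

lemma m_eq: "m = (\<Sum>k\<le>N. pmf \<theta> k * real k)"
  unfolding m_def by (subst integral_measure_pmf_real[of "{..N}"]) (use bounded in \<open>auto simp: mult.commute\<close>)

lemma genfun_deriv: "(genfun \<theta> N has_real_derivative m) (at 1)"
  unfolding genfun_def[abs_def] m_eq by (auto intro!: derivative_eq_intros sum.cong)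

text \<open>At the fixed point \<open>1\<close> the slope is \<open>m\<close>, which is less than
  \<open>a\<close>, so just to the right of \<open>1\<close> the graph lies below the line of slope
  \<open>a\<close>.\<close>

lemma genfun_growth:
  assumes "m < a"
  obtains \<delta> where "0 < \<delta>" "\<delta> \<le> 1" "\<And>x. 0 \<le> x \<Longrightarrow> x \<le> \<delta> \<Longrightarrow> genfun \<theta> N (1 + x) \<le> 1 + a * x"
proof -
  have "((\<lambda>x. genfun \<theta> N x - a * x) has_real_derivative m - a) (at 1)"
    by (auto intro!: derivative_eq_intros genfun_deriv)
  from DERIV_neg_dec_right[OF this] assms obtain d where d: "d > 0"
    "\<And>h. h > 0 \<Longrightarrow> h < d \<Longrightarrow> genfun \<theta> N (1 + h) - a * (1 + h) < genfun \<theta> N 1 - a * 1"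
    by auto
  show thesis
  proof
    show "0 < min 1 (d / 2)" "min 1 (d / 2) \<le> 1" using d by auto
    show "genfun \<theta> N (1 + x) \<le> 1 + a * x" if "0 \<le> x" "x \<le> min 1 (d / 2)" for x
    proof (cases "x = 0")
      case False
      with that d(1) d(2)[of x] genfun_1[OF bounded] show ?thesis by (auto simp: algebra_simps)
    qed (simp add: genfun_1[OF bounded])
  qed
qed

text \<open>Conditioning on the first generation applies \<open>genfun\<close> once more.\<close>

lemma nn_integral_power_generation:
  assumes "0 \<le> y"
  shows "(\<integral>\<^sup>+c. ennreal (y ^ generation n c) \<partial>gw \<theta>) = ennreal ((genfun \<theta> N ^^ n) y)"
proof (induction n)
  case 0
  show ?case using assms gw.emeasure_space_1[of \<theta>] by simp
next
  case (Suc n)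
  have "(\<integral>\<^sup>+c. ennreal (\<Prod>i<c []. y ^ generation n (shift [i] c)) \<partial>gw \<theta>)
      = ennreal (genfun \<theta> N ((genfun \<theta> N ^^ n) y))"
    using assms Suc by (intro nn_integral_children bounded) (auto intro: funpow_genfun_nonneg)
  then show ?case by (simp add: power_sum)
qed

text \<open>Iterating \<open>n\<close> times from \<open>1 + \<delta> / a ^ n\<close> stays below
  \<open>1 + \<delta>\<close>, where one step multiplies the excess over \<open>1\<close> by at most
  \<open>a\<close>. This bounds an exponential moment by \<open>2\<close>, and Markov's inequality
  gives the tail.\<close>

lemma generation_tail:
  assumes "m < a"
  obtains \<delta> where "0 < \<delta>"
    "\<And>n y. gw.prob \<theta> {c. y < real (generation n c)} \<le> 2 * exp (- \<delta> * y / a ^ n)"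
proof -
  obtain \<delta> where \<delta>: "0 < \<delta>" "\<delta> \<le> 1"
    "\<And>x. 0 \<le> x \<Longrightarrow> x \<le> \<delta> \<Longrightarrow> genfun \<theta> N (1 + x) \<le> 1 + a * x"
    using genfun_growth[OF assms] by blast
  have a: "1 < a" using assms m_gt_1 by simp
  show thesis
  proof
    show "0 < \<delta> / 2" using \<delta> by simp
    fix n :: nat and y :: real
    define x where "x = \<delta> / a ^ n"
    have x: "0 < x" "x \<le> 1"
      using \<delta> a by (auto simp: x_def divide_simps intro: order_trans[OF \<delta>(2)])
    have iter: "j \<le> n \<Longrightarrow> (genfun \<theta> N ^^ j) (1 + x) \<le> 1 + a ^ j * x" for j
    proof (induction j)
      case (Suc j)
      have "a ^ j * x \<le> a ^ n * x" using a x Suc.prems by (intro mult_right_mono power_increasing) auto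
      then have le: "a ^ j * x \<le> \<delta>" using a by (simp add: x_def)
      have "(genfun \<theta> N ^^ Suc j) (1 + x) \<le> genfun \<theta> N (1 + a ^ j * x)"
        using Suc x by (auto intro!: genfun_mono funpow_genfun_nonneg)
      also have "\<dots> \<le> 1 + a * (a ^ j * x)" using \<delta>(3) le a x by simp
      finally show ?case by (simp add: mult.assoc)
    qed simp
    have le2: "(genfun \<theta> N ^^ n) (1 + x) \<le> 2" using iter[of n] \<delta>(2) a by (simp add: x_def)
    then have mgf: "(\<integral>\<^sup>+c. ennreal ((1 + x) ^ generation n c) \<partial>gw \<theta>) \<le> ennreal 2"
      using x ennreal_leI[OF le2] by (subst nn_integral_power_generation) auto
    \<comment> \<open>Replaces the base \<open>1 + x\<close> by an exponential. The halved exponent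
      is why the rate is \<open>\<delta> / 2\<close>.\<close>
    have "exp (x / 2) \<le> 1 + x / 2 + (x / 2)\<^sup>2" using x by (intro exp_bound) auto
    also have "\<dots> \<le> 1 + x" using x by (simp add: power2_eq_square algebra_simps)
       (use mult_left_le_one_le[of x x] in linarith)
    finally have e: "exp (x / 2) \<le> 1 + x" .
    have "{c. y < real (generation n c)}
       \<subseteq> {c \<in> space (gw \<theta>). 1 \<le> ennreal (exp (- (x / 2) * y)) * ennreal ((1 + x) ^ generation n c)}"
    proof safe
      fix c assume "y < real (generation n c)"
      then have "1 \<le> exp (- (x / 2) * y) * exp (real (generation n c) * (x / 2))"
        using x by (simp add: exp_add[symmetric] algebra_simps)
      also have "\<dots> \<le> exp (- (x / 2) * y) * (1 + x) ^ generation n c"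
        unfolding exp_of_nat_mult using e by (intro mult_left_mono power_mono) auto
      finally show "1 \<le> ennreal (exp (- (x / 2) * y)) * ennreal ((1 + x) ^ generation n c)"
        using x by (simp add: ennreal_mult[symmetric] ennreal_1[symmetric] del: ennreal_1)
    qed simp
    then have "emeasure (gw \<theta>) {c. y < real (generation n c)}
       \<le> emeasure (gw \<theta>) {c \<in> space (gw \<theta>). 1 \<le> ennreal (exp (- (x / 2) * y)) * ennreal ((1 + x) ^ generation n c)}"
      by (intro emeasure_mono) measurable
    also have "\<dots> \<le> ennreal (exp (- (x / 2) * y)) * (\<integral>\<^sup>+c. ennreal ((1 + x) ^ generation n c) \<partial>gw \<theta>)"
      using nn_integral_Markov_inequality[of "\<lambda>c. ennreal ((1 + x) ^ generation n c)" "space (gw \<theta>)"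
         "gw \<theta>" "ennreal (exp (- (x / 2) * y))"] by simp
    also have "\<dots> \<le> ennreal (exp (- (x / 2) * y)) * ennreal 2"
      by (intro mult_left_mono mgf) simp
    also have "\<dots> = ennreal (exp (- (x / 2) * y) * 2)" by (subst ennreal_mult) auto
    finally have "gw.prob \<theta> {c. y < real (generation n c)} \<le> exp (- (x / 2) * y) * 2"
      by (simp add: gw.emeasure_eq_measure)
    then show "gw.prob \<theta> {c. y < real (generation n c)} \<le> 2 * exp (- (\<delta> / 2) * y / a ^ n)"
      by (simp add: x_def mult.commute)
  qed
qed

section \<open>Almost sure growth, uniformly over the nodes of early levels\<close>

lemma AE_offspring_le: "AE c in gw \<theta>. \<forall>v. c v \<le> N"
proof -
  have "AE c in gw \<theta>. c v \<le> N" for v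
    unfolding gw_def by (rule AE_PiM_component)
      (use bounded in \<open>auto simp: prob_space_measure_pmf AE_measure_pmf_iff\<close>)
  then show ?thesis by (simp add: AE_all_countable)
qed

lemma set_tree_subset:
  assumes "\<forall>v. c v \<le> N" "v \<in> tree c"
  shows "set v \<subseteq> {..<N}"
  using assms(2)
proof induction
  case (child v i)
  then show ?case using assms(1) less_le_trans[of i "c v" N] by auto
qed simp

text \<open>The bound is crude; all that matters is that the number of addresses up to level
  \<open>k\<close> is at most exponential in \<open>k\<close>.\<close>

lemma card_lists_le:
  "real (card {v. set v \<subseteq> {..<N} \<and> length v \<le> k}) \<le> real (2 * (N + 1)) ^ k"
proof -
  have "card {v. set v \<subseteq> {..<N} \<and> length v \<le> k} = (\<Sum>i\<le>k. N ^ i)"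
    by (subst card_lists_length_le) auto
  also have "\<dots> \<le> (\<Sum>i\<le>k. (N + 1) ^ k)"
  proof (rule sum_mono)
    fix i assume "i \<in> {..k}"
    then have "N ^ i \<le> (N + 1) ^ i" "(N + 1) ^ i \<le> (N + 1) ^ k"
      by (auto intro!: power_mono power_increasing)
    then show "N ^ i \<le> (N + 1) ^ k" by simp
  qed
  also have "\<dots> \<le> 2 ^ k * (N + 1) ^ k"
    using mult_right_mono[of "Suc k" "2 ^ k" "(N + 1) ^ k"] less_exp[of k] by simp
  also have "\<dots> = (2 * (N + 1)) ^ k" by (simp only: power_mult_distrib)
  finally show ?thesis unfolding of_nat_power[symmetric] of_nat_le_iff .
qed

lemma AE_generation_le:
  assumes "m < b"
  shows "AE c in gw \<theta>. \<exists>\<gamma>>1. \<forall>\<^sub>F n in sequentially. \<forall>v\<in>tree c. real (length v) \<le> \<gamma> ^ n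
           \<longrightarrow> real (generation n (shift v c)) \<le> b ^ n"
proof -
  \<comment> \<open>With \<open>a\<close> strictly between \<open>m\<close> and \<open>b\<close>,
    the tail at \<open>b ^ n\<close> is doubly exponentially small.\<close>
  define a where "a = (m + b) / 2"
  have a: "m < a" "a < b" "1 < a" using assms m_gt_1 by (auto simp: a_def)
  obtain \<delta> where \<delta>: "0 < \<delta>"
    "\<And>n y. gw.prob \<theta> {c. y < real (generation n c)} \<le> 2 * exp (- \<delta> * y / a ^ n)"
    using generation_tail[OF a(1)] by blast
  \<comment> \<open>The square root makes the tail exponent
    \<open>\<delta> * \<gamma> ^ (2 * n)\<close> outgrow the exponent
    \<open>C * \<gamma> ^ n\<close> that comes from counting addresses.\<close>
  define \<gamma> where "\<gamma> = sqrt (b / a)"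
  have \<gamma>: "1 < \<gamma>" "b / a = \<gamma>\<^sup>2" using a by (auto simp: \<gamma>_def)
  define C where "C = ln (real (2 * (N + 1)))"
  have C: "0 < C" by (simp add: C_def)
  \<comment> \<open>A deterministic finite set of addresses that almost surely contains all nodes up
    to level \<open>\<gamma> ^ n\<close>; the union bound needs a set that does not depend on the
    tree.\<close>
  define V where "V n = {v. set v \<subseteq> {..<N} \<and> length v \<le> nat \<lfloor>\<gamma> ^ n\<rfloor>}" for n
  define A where "A n = (\<Union>v\<in>V n. {c. b ^ n < real (generation n (shift v c))})" for n
  have finV: "finite (V n)" for n
    unfolding V_def using finite_lists_length_le[of "{..<N}"] by simp
  have [measurable]: "A n \<in> sets (gw \<theta>)" for n
    unfolding A_def using finV
  proof (intro sets.finite_UN)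
    fix v
    have "{c \<in> space (gw \<theta>). b ^ n < real (generation n (shift v c))} \<in> sets (gw \<theta>)" by measurable
    then show "{c. b ^ n < real (generation n (shift v c))} \<in> sets (gw \<theta>)" by simp
  qed
  have prob_A: "gw.prob \<theta> (A n) \<le> 2 * exp (C * \<gamma> ^ n - \<delta> * (\<gamma> ^ n)\<^sup>2)" for n
  proof -
    have eq: "gw.prob \<theta> {c. b ^ n < real (generation n (shift v c))}
        = gw.prob \<theta> {c. b ^ n < real (generation n c)}" for v
    proof -
      have "{c \<in> space (gw \<theta>). b ^ n < real (generation n c)} \<in> sets (gw \<theta>)" by measurable
      then have "measure (distr (gw \<theta>) (gw \<theta>) (shift v)) {c. b ^ n < real (generation n c)}
        = gw.prob \<theta> {c. b ^ n < real (generation n (shift v c))}"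
        by (subst measure_distr) (auto simp: vimage_def)
      then show ?thesis by (simp add: distr_shift)
    qed
    have meas: "{c. b ^ n < real (generation n (shift v c))} \<in> sets (gw \<theta>)" for v
    proof -
      have "{c \<in> space (gw \<theta>). b ^ n < real (generation n (shift v c))} \<in> sets (gw \<theta>)" by measurable
      then show ?thesis by simp
    qed
    have "gw.prob \<theta> (A n) \<le> (\<Sum>v\<in>V n. gw.prob \<theta> {c. b ^ n < real (generation n (shift v c))})"
      unfolding A_def using finV meas by (intro gw.finite_measure_subadditive_finite) auto
    also have "\<dots> \<le> real (card (V n)) * (2 * exp (- \<delta> * b ^ n / a ^ n))"
      unfolding eq using \<delta>(2)[of "b ^ n" n] by (simp add: mult_left_mono)
    also have "- \<delta> * b ^ n / a ^ n = - \<delta> * (\<gamma> ^ n)\<^sup>2"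
    proof -
      have "(\<gamma> ^ n)\<^sup>2 = b ^ n / a ^ n" by (metis \<gamma>(2) mult.commute power_divide power_mult)
      then show ?thesis by simp
    qed
    also have "real (card (V n)) \<le> exp (C * \<gamma> ^ n)"
    proof -
      have "real (card (V n)) \<le> real (2 * (N + 1)) ^ nat \<lfloor>\<gamma> ^ n\<rfloor>"
        unfolding V_def by (rule card_lists_le)
      also have "\<dots> = exp (real (nat \<lfloor>\<gamma> ^ n\<rfloor>) * C)" by (simp add: C_def exp_of_nat_mult)
      also have "\<dots> \<le> exp (C * \<gamma> ^ n)"
        using C \<gamma>(1) by (simp add: mult.commute mult_left_mono)
      finally show ?thesis .
    qed
    finally show ?thesis by (simp add: exp_diff exp_minus divide_inverse mult_ac mult_left_mono)
  qed
  have "summable (\<lambda>n. gw.prob \<theta> (A n))"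
  proof (rule summable_comparison_test_ev)
    have "eventually (\<lambda>n. C * \<gamma> ^ n - \<delta> * (\<gamma> ^ n)\<^sup>2 \<le> - real n) sequentially"
      using C \<gamma>(1) \<delta>(1) by real_asymp
    then show "eventually (\<lambda>n. norm (gw.prob \<theta> (A n)) \<le> 2 * exp (- 1) ^ n) sequentially"
    proof eventually_elim
      case (elim n)
      have "gw.prob \<theta> (A n) \<le> 2 * exp (- real n)"
        using prob_A[of n] elim by (smt (verit) exp_le_cancel_iff)
      then show ?case by (simp add: exp_of_nat_mult[symmetric])
    qed
    show "summable (\<lambda>n. 2 * exp (- 1 :: real) ^ n)" by (intro summable_mult summable_geometric) simp
  qed
  then have "AE c in gw \<theta>. eventually (\<lambda>n. c \<in> space (gw \<theta>) - A n) sequentially"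
    by (intro borel_cantelli_AE1) (auto simp: gw.emeasure_eq_measure)
  with AE_offspring_le show ?thesis
  proof eventually_elim
    case (elim c)
    show ?case
    proof (intro exI conjI)
      show "1 < \<gamma>" by fact
      from elim(2) show "\<forall>\<^sub>F n in sequentially. \<forall>v\<in>tree c. real (length v) \<le> \<gamma> ^ n
           \<longrightarrow> real (generation n (shift v c)) \<le> b ^ n"
      proof eventually_elim
        case (elim n)
        show ?case
        proof (intro ballI impI)
          fix v assume v: "v \<in> tree c" "real (length v) \<le> \<gamma> ^ n"
          have "v \<in> V n"
            using set_tree_subset[OF \<open>\<forall>v. c v \<le> N\<close> v(1)] v(2) by (auto simp: V_def le_nat_floor)
          then show "real (generation n (shift v c)) \<le> b ^ n"
            using elim by (auto simp: A_def not_less)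
        qed
      qed
    qed
  qed
qed

end

section \<open>Percolation\<close>

text \<open>Keep every edge of the tree with probability \<open>p\<close>, independently. Then \<open>cut_prob p n c\<close> is the
  probability that the root is not connected to generation \<open>n\<close>.\<close>

primrec cut_prob :: "real \<Rightarrow> nat \<Rightarrow> (nat list \<Rightarrow> nat) \<Rightarrow> real" where
  "cut_prob p 0 c = 0"
| "cut_prob p (Suc n) c = (\<Prod>i<c []. 1 - p + p * cut_prob p n (shift [i] c))"

text \<open>Given the tree, the probability that the percolation cluster of the root is finite; the
  events increase with \<open>n\<close>, so this is a limit.\<close>

definition cut_prob_lim :: "real \<Rightarrow> (nat list \<Rightarrow> nat) \<Rightarrow> real" where
  "cut_prob_lim p c = (SUP n. cut_prob p n c)"

lemma convex_comb_bounds: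
  fixes p u :: real
  assumes "0 \<le> p" "p \<le> 1" "0 \<le> u" "u \<le> 1"
  shows "0 \<le> 1 - p + p * u" "1 - p + p * u \<le> 1"
  using assms mult_left_le[of u p] by (auto simp: add_nonneg_nonneg)

context
  fixes p :: real
  assumes p: "0 < p" "p < 1"
begin

lemma cut_prob_bounds: "0 \<le> cut_prob p n c \<and> cut_prob p n c \<le> 1"
  using p by (induction n arbitrary: c) (auto intro!: prod_nonneg prod_le_1 convex_comb_bounds)

lemma cut_prob_Suc_mono: "cut_prob p n c \<le> cut_prob p (Suc n) c"
proof (induction n arbitrary: c)
  case (Suc n)
  have "(\<Prod>i<c []. 1 - p + p * cut_prob p n (shift [i] c))
      \<le> (\<Prod>i<c []. 1 - p + p * cut_prob p (Suc n) (shift [i] c))"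
    using p cut_prob_bounds
    by (intro prod_mono conjI convex_comb_bounds add_left_mono mult_left_mono Suc.IH) auto
  then show ?case by simp
qed (metis cut_prob.simps(1) cut_prob_bounds)

lemma cut_prob_tendsto: "(\<lambda>n. cut_prob p n c) \<longlonglongrightarrow> cut_prob_lim p c"
  unfolding cut_prob_lim_def using cut_prob_bounds
  by (intro LIMSEQ_incseq_SUP) (auto intro!: incseq_SucI cut_prob_Suc_mono bdd_aboveI2[of _ _ 1] simp del: cut_prob.simps)

lemma cut_prob_le_cut_prob_lim: "cut_prob p n c \<le> cut_prob_lim p c"
  by (rule incseq_le[OF _ cut_prob_tendsto]) (auto intro!: incseq_SucI cut_prob_Suc_mono simp del: cut_prob.simps)

lemma cut_prob_lim_bounds: "0 \<le> cut_prob_lim p c" "cut_prob_lim p c \<le> 1"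
  using cut_prob_le_cut_prob_lim[of 0 c] LIMSEQ_le_const2[OF cut_prob_tendsto, of c 1] cut_prob_bounds by auto

lemma cut_prob_lim_rec: "cut_prob_lim p c = (\<Prod>i<c []. 1 - p + p * cut_prob_lim p (shift [i] c))"
proof (rule LIMSEQ_unique)
  show "(\<lambda>n. cut_prob p (Suc n) c) \<longlonglongrightarrow> cut_prob_lim p c"
    by (rule LIMSEQ_Suc[OF cut_prob_tendsto])
  show "(\<lambda>n. cut_prob p (Suc n) c) \<longlonglongrightarrow> (\<Prod>i<c []. 1 - p + p * cut_prob_lim p (shift [i] c))"
    unfolding cut_prob.simps by (intro tendsto_intros cut_prob_tendsto)
qed

text \<open>Union bound over the edges at the root: to survive, an open edge must lead to a
  surviving child.\<close>

lemma one_minus_cut_prob_lim_le: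
  "1 - cut_prob_lim p c \<le> (\<Sum>i<c []. p * (1 - cut_prob_lim p (shift [i] c)))"
proof -
  \<comment> \<open>The Weierstrass product inequality, the analytic form of the union
    bound.\<close>
  have *: "1 - (\<Prod>i<k. 1 - x i) \<le> (\<Sum>i<k. x i)" if "\<And>i. 0 \<le> x i \<and> x i \<le> 1" for k :: nat and x :: "nat \<Rightarrow> real"
  proof (induction k)
    case (Suc k)
    have "0 \<le> (\<Prod>i<k. 1 - x i)" "(\<Prod>i<k. 1 - x i) \<le> 1"
      using that by (auto intro!: prod_nonneg prod_le_1)
    then have "(\<Prod>i<k. 1 - x i) * x k \<le> x k" using that[of k] by (simp add: mult_left_le_one_le)
    with Suc show ?case by (simp add: algebra_simps)
  qed simp
  have "1 - (\<Prod>i<c []. 1 - p * (1 - cut_prob_lim p (shift [i] c))) \<le> (\<Sum>i<c []. p * (1 - cut_prob_lim p (shift [i] c)))"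
    using p cut_prob_lim_bounds by (intro *) (auto intro!: mult_nonneg_nonneg mult_le_one)
  then show ?thesis by (subst cut_prob_lim_rec) (simp add: algebra_simps)
qed

text \<open>A product of factors in \<open>[0, 1]\<close> equals \<open>1\<close> only if each
  factor does. This hereditary form makes the probability of the event a fixed point of the
  generating function.\<close>

lemma cut_prob_lim_eq_1_iff: "cut_prob_lim p c = 1 \<longleftrightarrow> (\<forall>i<c []. cut_prob_lim p (shift [i] c) = 1)"
proof
  assume 1: "cut_prob_lim p c = 1"
  show "\<forall>i<c []. cut_prob_lim p (shift [i] c) = 1"
  proof (rule ccontr)
    assume "\<not> ?thesis"
    then obtain j where j: "j < c []" "cut_prob_lim p (shift [j] c) < 1"
      using cut_prob_lim_bounds by (metis order_le_less)
    let ?f = "\<lambda>i. 1 - p + p * cut_prob_lim p (shift [i] c)"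
    have f: "0 \<le> ?f i" "?f i \<le> 1" for i
      using p cut_prob_lim_bounds by (auto intro!: convex_comb_bounds)
    have "(\<Prod>i<c []. ?f i) = ?f j * (\<Prod>i\<in>{..<c []} - {j}. ?f i)"
      using j by (subst prod.remove[of _ j]) auto
    also have "\<dots> \<le> ?f j * 1"
      using f by (intro mult_left_mono prod_le_1) auto
    also have "\<dots> < 1" using p j by simp
    finally show False using 1 cut_prob_lim_rec[of c] by simp
  qed
next
  assume "\<forall>i<c []. cut_prob_lim p (shift [i] c) = 1"
  then show "cut_prob_lim p c = 1" by (subst cut_prob_lim_rec) simp
qed

lemma measurable_cut_prob [measurable]: "cut_prob p n \<in> borel_measurable (gw \<theta>)"
proof (induction n)
  case (Suc n)
  note [measurable] = Suc
  show ?case unfolding cut_prob.simps by measurable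
qed simp

lemma measurable_cut_prob_lim [measurable]: "cut_prob_lim p \<in> borel_measurable (gw \<theta>)"
  by (rule borel_measurable_LIMSEQ_real[OF cut_prob_tendsto]) measurable

lemma cut_prob_eq_1: "generation n c = 0 \<Longrightarrow> cut_prob p n c = 1"
  by (induction n arbitrary: c) auto

lemma finite_tree_cut_prob_lim: "finite (tree c) \<Longrightarrow> cut_prob_lim p c = 1"
  using tree_finite_iff[of c] cut_prob_eq_1 cut_prob_le_cut_prob_lim cut_prob_lim_bounds
  by (metis order_antisym)

end

text \<open>A tree is its root with finitely many relabelled subtrees attached. Extinction thus has
  the same hereditary form as the event \<open>cut_prob_lim p c = 1\<close>.\<close>

lemma finite_tree_iff_children: "finite (tree c) \<longleftrightarrow> (\<forall>i<c []. finite (tree (shift [i] c)))"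
proof -
  have "tree c = insert [] (\<Union>i<c []. (#) i ` tree (shift [i] c))"
  proof (intro set_eqI)
    show "v \<in> tree c \<longleftrightarrow> v \<in> insert [] (\<Union>i<c []. (#) i ` tree (shift [i] c))" for v
      by (cases v) (auto simp: tree_Cons_iff)
  qed
  then have "finite (tree c) \<longleftrightarrow> finite (insert [] (\<Union>i<c []. (#) i ` tree (shift [i] c)))" by metis
  then show ?thesis by (auto simp: finite_image_iff inj_on_def)
qed

lemma sets_finite_tree [measurable]: "{c. finite (tree c)} \<in> sets (gw \<theta>)"
proof -
  have "{c \<in> space (gw \<theta>). \<exists>n. generation n c = 0} \<in> sets (gw \<theta>)" by measurable
  then show ?thesis by (simp add: tree_finite_iff)
qed

section \<open>Fixed points of the generating function and survival of percolation\<close>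

context supercritical
begin

text \<open>The indicator of a hereditary event is the product of its indicators over the root
  subtrees, and the branching property evaluates the mean of that product.\<close>

lemma prob_hereditary_fixed_point:
  assumes meas: "{c. P c} \<in> sets (gw \<theta>)" and her: "\<And>c. P c \<longleftrightarrow> (\<forall>i<c []. P (shift [i] c))"
  shows "genfun \<theta> N (gw.prob \<theta> {c. P c}) = gw.prob \<theta> {c. P c}"
proof -
  let ?g = "\<lambda>c. indicator {c. P c} c :: real"
  have int: "(\<integral>\<^sup>+c. ennreal (?g c) \<partial>gw \<theta>) = ennreal (gw.prob \<theta> {c. P c})"
    using meas by (simp add: ennreal_indicator gw.emeasure_eq_measure)
  have "(\<Prod>i<c []. ?g (shift [i] c)) = ?g c" for c
  proof (cases "P c")
    case True
    then show ?thesis using her[of c] by simp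
  next
    case False
    then obtain i where "i < c []" "\<not> P (shift [i] c)" using her[of c] by blast
    then show ?thesis using False by (auto intro!: prod_zero bexI[of _ i])
  qed
  moreover have "(\<integral>\<^sup>+c. ennreal (\<Prod>i<c []. ?g (shift [i] c)) \<partial>gw \<theta>) = ennreal (genfun \<theta> N (gw.prob \<theta> {c. P c}))"
    using meas int by (intro nn_integral_children bounded) auto
  ultimately have "ennreal (gw.prob \<theta> {c. P c}) = ennreal (genfun \<theta> N (gw.prob \<theta> {c. P c}))"
    using int by simp
  then show ?thesis by (simp add: genfun_nonneg)
qed

text \<open>Otherwise the offspring mean would be at most \<open>1\<close>. This supplies the strict
  monotonicity in the uniqueness argument below.\<close>

lemma ex_offspring_ge_2: "\<exists>k\<ge>2. k \<le> N \<and> 0 < pmf \<theta> k"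
proof (rule ccontr)
  assume no: "\<not> ?thesis"
  have "m \<le> (\<Sum>k\<le>N. pmf \<theta> k * 1)"
    unfolding m_eq
  proof (rule sum_mono)
    fix k assume "k \<in> {..N}"
    then have "k < 2 \<or> pmf \<theta> k = 0" using no by (metis atMost_iff not_less pmf_nonneg order_le_less)
    then show "pmf \<theta> k * real k \<le> pmf \<theta> k * 1" by (auto simp: mult_left_le)
  qed
  also have "\<dots> = 1" using sum_pmf_eq_1[of "{..N}" \<theta>] bounded by (simp add: atMost_atLeast0)
  finally show False using m_gt_1 by simp
qed

text \<open>The difference quotient \<open>H z\<close> of the generating function between
  \<open>z\<close> and \<open>1\<close>, written as a polynomial, equals \<open>1\<close> at a fixed
  point below \<open>1\<close>. It is strictly increasing for nonnegative \<open>z\<close> since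
  some \<open>k \<ge> 2\<close> has positive weight.\<close>

lemma genfun_fixed_point_unique:
  assumes "0 \<le> x" "x < 1" "0 \<le> y" "y < 1" and "genfun \<theta> N x = x" "genfun \<theta> N y = y"
  shows "x = y"
proof -
  define H where "H z = (\<Sum>k\<le>N. pmf \<theta> k * (\<Sum>j<k. z ^ j))" for z :: real
  have H1: "H z = 1" if "z < 1" "genfun \<theta> N z = z" for z
  proof -
    have "(1 - z) * H z = (\<Sum>k\<le>N. pmf \<theta> k * (1 - z ^ k))"
      unfolding H_def one_diff_power_eq by (simp add: sum_distrib_left mult_ac)
    also have "\<dots> = genfun \<theta> N 1 - genfun \<theta> N z" by (simp add: genfun_def sum_subtractf algebra_simps)
    also have "\<dots> = 1 - z" using that genfun_1[OF bounded] by simp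
    finally show ?thesis using that by simp
  qed
  have "H x < H y" if "0 \<le> x" "x < y" for x y
  proof -
    obtain k where k: "k \<ge> 2" "k \<le> N" "0 < pmf \<theta> k" using ex_offspring_ge_2 by blast
    show ?thesis unfolding H_def
    proof (rule sum_strict_mono_ex1)
      show "\<forall>k\<in>{..N}. pmf \<theta> k * (\<Sum>j<k. x ^ j) \<le> pmf \<theta> k * (\<Sum>j<k. y ^ j)"
        using that by (intro ballI mult_left_mono sum_mono power_mono) auto
      have "(\<Sum>j<k. x ^ j) < (\<Sum>j<k. y ^ j)"
        using that k by (intro sum_strict_mono_ex1) (auto intro!: power_mono bexI[of _ 1])
      then show "\<exists>k\<in>{..N}. pmf \<theta> k * (\<Sum>j<k. x ^ j) < pmf \<theta> k * (\<Sum>j<k. y ^ j)"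
        using k by (intro bexI[of _ k]) auto
    qed simp
  qed
  with H1 assms show ?thesis by (metis linorder_neqE_linordered_idom less_irrefl)
qed

text \<open>Percolation thins the offspring law; the thinned generating function \<open>h\<close>
  has slope \<open>m * p > 1\<close> at \<open>1\<close> and therefore dips below the diagonal left
  of \<open>1\<close>. Its iterates from \<open>0\<close> are the means of
  \<open>cut_prob p n\<close> and stay below such a point.\<close>

lemma nn_integral_cut_prob_lim:
  assumes p: "1 / m < p" "p < 1"
  shows "(\<integral>\<^sup>+c. ennreal (cut_prob_lim p c) \<partial>gw \<theta>) < 1"
proof -
  have p0: "0 < p" using p m_gt_1 by (smt (verit) divide_pos_pos)
  note p' = p0 p(2)
  define h where "h z = genfun \<theta> N (1 - p + p * z)" for z
  have mp: "1 < m * p" using p m_gt_1 by (simp add: field_simps)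
  have "((\<lambda>z. h z - z) has_real_derivative m * p - 1) (at 1)"
  proof -
    have "((\<lambda>z. genfun \<theta> N (1 - p + p * z)) has_real_derivative m * p) (at 1)"
      by (rule DERIV_chain2[of "genfun \<theta> N" m "\<lambda>z. 1 - p + p * z"])
        (auto intro!: derivative_eq_intros genfun_deriv)
    then show ?thesis unfolding h_def by (auto intro!: derivative_eq_intros)
  qed
  from DERIV_pos_inc_left[OF this] mp obtain d where d: "0 < d"
    "\<And>t. 0 < t \<Longrightarrow> t < d \<Longrightarrow> h (1 - t) - (1 - t) < h 1 - 1" by auto
  \<comment> \<open>A point left of \<open>1\<close> at which \<open>h z \<le> z\<close>; the cap
    \<open>1/2\<close> keeps it positive.\<close>
  define z where "z = 1 - min (1/2) (d / 2)"
  have z: "0 < z" "z < 1" using d(1) by (auto simp: z_def)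
  have hz: "h z \<le> z"
  proof -
    have "0 < 1 - z" "1 - z < d" using d(1) by (auto simp: z_def)
    from d(2)[OF this] show ?thesis using genfun_1[OF bounded] by (simp add: h_def)
  qed
  \<comment> \<open>The point \<open>z\<close> is a barrier: \<open>h\<close> is increasing and
    \<open>h z \<le> z\<close>, so the means, which start at \<open>0\<close>, never cross
    it.\<close>
  have "\<exists>e\<ge>0. e \<le> z \<and> (\<integral>\<^sup>+c. ennreal (cut_prob p n c) \<partial>gw \<theta>) = ennreal e" for n
  proof (induction n)
    case 0
    show ?case using z by (intro exI[of _ 0]) auto
  next
    case (Suc n)
    note [measurable] = measurable_cut_prob[OF p'] and cb = cut_prob_bounds[OF p']
    from Suc obtain e where e: "0 \<le> e" "e \<le> z" "(\<integral>\<^sup>+c. ennreal (cut_prob p n c) \<partial>gw \<theta>) = ennreal e" by auto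
    have "(\<integral>\<^sup>+c. ennreal (1 - p + p * cut_prob p n c) \<partial>gw \<theta>)
        = (\<integral>\<^sup>+c. ennreal (1 - p) + ennreal p * ennreal (cut_prob p n c) \<partial>gw \<theta>)"
      using p' cb by (intro nn_integral_cong) (simp add: ennreal_plus[symmetric] ennreal_mult[symmetric] del: ennreal_plus)
    also have "\<dots> = ennreal (1 - p) + ennreal p * ennreal e"
      using e gw.emeasure_space_1[of \<theta>] by (simp add: nn_integral_add nn_integral_cmult)
    also have "\<dots> = ennreal (1 - p + p * e)"
      using p' e by (simp add: ennreal_plus[symmetric] ennreal_mult[symmetric] del: ennreal_plus)
    finally have "(\<integral>\<^sup>+c. ennreal (1 - p + p * cut_prob p n c) \<partial>gw \<theta>) = ennreal (1 - p + p * e)" .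
    then have "(\<integral>\<^sup>+c. ennreal (cut_prob p (Suc n) c) \<partial>gw \<theta>) = ennreal (h e)"
      unfolding cut_prob.simps h_def
      using p' e cb z by (intro nn_integral_children bounded) (auto intro: convex_comb_bounds)
    moreover have "h e \<le> z" "0 \<le> h e"
      using e hz p' z genfun_mono[of "1 - p + p * e" "1 - p + p * z" \<theta> N] convex_comb_bounds[of p e]
      by (auto simp: h_def mult_left_mono intro!: genfun_nonneg)
    ultimately show ?case by blast
  qed
  then have le: "(\<integral>\<^sup>+c. ennreal (cut_prob p n c) \<partial>gw \<theta>) \<le> ennreal z" for n by (metis ennreal_leI)
  note [measurable] = measurable_cut_prob[OF p'] measurable_cut_prob_lim[OF p']
  have "(\<integral>\<^sup>+c. ennreal (cut_prob_lim p c) \<partial>gw \<theta>) = (\<integral>\<^sup>+c. (SUP n. ennreal (cut_prob p n c)) \<partial>gw \<theta>)"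
  proof (rule nn_integral_cong)
    fix c
    have "(\<lambda>n. ennreal (cut_prob p n c)) \<longlonglongrightarrow> (SUP n. ennreal (cut_prob p n c))"
      by (rule LIMSEQ_SUP, intro incseq_SucI ennreal_leI cut_prob_Suc_mono[OF p'])
    then show "ennreal (cut_prob_lim p c) = (SUP n. ennreal (cut_prob p n c))"
      using tendsto_ennrealI[OF cut_prob_tendsto[OF p', of c]] LIMSEQ_unique by blast
  qed
  also have "\<dots> = (SUP n. \<integral>\<^sup>+c. ennreal (cut_prob p n c) \<partial>gw \<theta>)"
  proof (rule nn_integral_monotone_convergence_SUP)
    show "incseq (\<lambda>n c. ennreal (cut_prob p n c))"
      by (intro incseq_SucI le_funI ennreal_leI cut_prob_Suc_mono[OF p'])
  qed measurable
  also have "\<dots> \<le> ennreal z" by (rule SUP_least) (rule le)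
  also have "\<dots> < 1" using z by (simp add: ennreal_less_one_iff)
  finally show ?thesis .
qed

text \<open>Extinction forces disconnection, and both probabilities are fixed points below
  \<open>1\<close>. Uniqueness makes them equal, so the difference of the events is null.\<close>

lemma AE_cut_prob_lim_less_1:
  assumes p: "1 / m < p" "p < 1"
  shows "AE c in gw \<theta>. infinite (tree c) \<longrightarrow> cut_prob_lim p c < 1"
proof -
  have p0: "0 < p" using p m_gt_1 by (smt (verit) divide_pos_pos)
  note p' = p0 p(2)
  note [measurable] = measurable_cut_prob_lim[OF p']
  let ?A = "{c. cut_prob_lim p c = 1}" and ?F = "{c. finite (tree c)}"
  have A [measurable]: "?A \<in> sets (gw \<theta>)"
  proof -
    have "{c \<in> space (gw \<theta>). cut_prob_lim p c = 1} \<in> sets (gw \<theta>)" by measurable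
    then show ?thesis by simp
  qed
  have sub: "?F \<subseteq> ?A" using finite_tree_cut_prob_lim[OF p'] by auto
  have "ennreal (gw.prob \<theta> ?A) = (\<integral>\<^sup>+c. indicator ?A c \<partial>gw \<theta>)"
    by (simp add: gw.emeasure_eq_measure)
  also have "\<dots> \<le> (\<integral>\<^sup>+c. ennreal (cut_prob_lim p c) \<partial>gw \<theta>)"
    by (intro nn_integral_mono) (auto simp: indicator_def)
  also have "\<dots> < 1" by (rule nn_integral_cut_prob_lim[OF p])
  finally have A1: "gw.prob \<theta> ?A < 1" by (simp add: ennreal_less_one_iff)
  have le: "gw.prob \<theta> ?F \<le> gw.prob \<theta> ?A" by (intro gw.finite_measure_mono sub A)
  have "gw.prob \<theta> ?F = gw.prob \<theta> ?A"
  proof (rule genfun_fixed_point_unique)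
    show "genfun \<theta> N (gw.prob \<theta> ?F) = gw.prob \<theta> ?F"
      by (rule prob_hereditary_fixed_point[OF sets_finite_tree finite_tree_iff_children])
    show "genfun \<theta> N (gw.prob \<theta> ?A) = gw.prob \<theta> ?A"
      by (rule prob_hereditary_fixed_point[OF A cut_prob_lim_eq_1_iff[OF p']])
  qed (use A1 le in \<open>simp_all add: order.strict_trans1\<close>)
  then have "gw.prob \<theta> (?A - ?F) = 0"
    using sub by (subst gw.finite_measure_Diff) auto
  then have "AE c in gw \<theta>. c \<notin> ?A - ?F"
    by (subst gw.prob_eq_0[symmetric]) auto
  then show ?thesis
    by (rule AE_mp) (auto intro!: AE_I2 simp: order_less_le cut_prob_lim_bounds[OF p'])
qed

end

section \<open>Covers of the boundary\<close>

lemma ray_length: "x \<in> rays T \<Longrightarrow> length (x n) = n"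
proof (induction n)
  case (Suc n)
  then obtain i where "x (Suc n) = x n @ [i]" by (auto simp: rays_def)
  with Suc show ?case by simp
qed (simp add: rays_def)

lemma ray_in_tree: "x \<in> rays T \<Longrightarrow> x n \<in> T"
  by (simp add: rays_def)

lemma ray_append:
  assumes x: "x \<in> rays T" and "k \<le> n"
  obtains u where "x n = x k @ u" "length u = n - k"
proof -
  have "\<exists>u. x n = x k @ u"
    using \<open>k \<le> n\<close>
  proof (induction n rule: dec_induct)
    case (step n)
    then show ?case using x by (auto simp: rays_def) (metis append_assoc)
  qed simp
  then obtain u where u: "x n = x k @ u" by blast
  then have "length u = n - k" using ray_length[OF x, of n] ray_length[OF x, of k] by simp
  with u show thesis by (rule that)
qed

text \<open>Rays that agree at a level agree at all earlier ones. Balls of radius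
  \<open>2 powr - real n\<close> thus consist of the rays through one node of level
  \<open>n\<close>, which turns covering into counting nodes.\<close>

lemma ray_dist_le_iff:
  assumes "x \<in> rays T" "y \<in> rays T"
  shows "ray_dist x y \<le> 2 powr - real n \<longleftrightarrow> x n = y n"
proof (cases "x = y")
  case False
  then have "ray_dist x y \<le> 2 powr - real n \<longleftrightarrow> n \<le> meet_level x y"
    by (simp add: ray_dist_def)
  with rays_agree_iff[OF assms False] show ?thesis by simp
qed (simp add: ray_dist_def)

section \<open>Upper and lower bounds for covering numbers\<close>

lemma covering_number_le:
  assumes "finite I" "0 < r" "\<And>i. i \<in> I \<Longrightarrow> x i \<in> mspace m" "E \<subseteq> (\<Union>i\<in>I. mcball_of m (x i) r)"
  shows "covering_number m r E \<le> enat (card I)"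
proof -
  have "covering_number m r E \<le> enat (card ((\<lambda>i. mcball_of m (x i) r) ` I))"
    unfolding covering_number_def using assms by (intro INF_lower) fast
  also have "\<dots> \<le> enat (card I)" using assms(1) by (simp add: card_image_le)
  finally show ?thesis .
qed

lemma covering_numberE:
  assumes "covering_number m r E \<le> enat k"
  obtains \<B> where "finite \<B>" "card \<B> \<le> k" "E \<subseteq> \<Union>\<B>"
    "\<And>B. B \<in> \<B> \<Longrightarrow> \<exists>x \<rho>. B = mcball_of m x \<rho> \<and> x \<in> mspace m \<and> 0 < \<rho> \<and> \<rho> \<le> r"
proof -
  \<comment> \<open>Covering numbers are integers: a strict bound by \<open>k + 1\<close> makes the
    infimum yield a cover by at most \<open>k\<close> balls.\<close>
  have "covering_number m r E < enat (Suc k)"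
    using assms by (simp add: order.strict_trans1)
  then obtain \<B> where "finite \<B>" "E \<subseteq> \<Union>\<B>" "card \<B> < Suc k"
    "\<B> \<subseteq> {mcball_of m x \<rho> | x \<rho>. x \<in> mspace m \<and> 0 < \<rho> \<and> \<rho> \<le> r}"
    unfolding covering_number_def INF_less_iff by auto
  then show thesis by (intro that[of \<B>]) auto
qed

text \<open>Enlarge each ball of the coarse cover to radius \<open>r\<close> about its own centre
  and cover it by at most \<open>j\<close> finer balls.\<close>

lemma covering_number_mult:
  assumes E: "covering_number m r E \<le> enat k"
    and B: "\<And>x. x \<in> mspace m \<Longrightarrow> covering_number m r' (mcball_of m x r) \<le> enat j"
  shows "covering_number m r' E \<le> enat (k * j)"
proof -
  obtain \<B> where \<B>: "finite \<B>" "card \<B> \<le> k" "E \<subseteq> \<Union>\<B>"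
    "\<And>B. B \<in> \<B> \<Longrightarrow> \<exists>x \<rho>. B = mcball_of m x \<rho> \<and> x \<in> mspace m \<and> 0 < \<rho> \<and> \<rho> \<le> r"
    by (rule covering_numberE[OF E]) blast
  have "\<exists>\<C>. \<forall>B\<in>\<B>. finite (\<C> B) \<and> card (\<C> B) \<le> j \<and> B \<subseteq> \<Union>(\<C> B) \<and>
          \<C> B \<subseteq> {mcball_of m x \<rho> | x \<rho>. x \<in> mspace m \<and> 0 < \<rho> \<and> \<rho> \<le> r'}"
  proof (rule bchoice, rule ballI)
    fix B assume mem: "B \<in> \<B>"
    obtain x \<rho> where x: "B = mcball_of m x \<rho>" "x \<in> mspace m" "\<rho> \<le> r" using \<B>(4)[OF mem] by blast
    obtain \<C> where "finite \<C>" "card \<C> \<le> j" "mcball_of m x r \<subseteq> \<Union>\<C>"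
      "\<And>B. B \<in> \<C> \<Longrightarrow> \<exists>x \<rho>. B = mcball_of m x \<rho> \<and> x \<in> mspace m \<and> 0 < \<rho> \<and> \<rho> \<le> r'"
      by (rule covering_numberE[OF B[OF x(2)]]) blast
    moreover have "B \<subseteq> mcball_of m x r" using x by auto
    ultimately show "\<exists>\<C>. finite \<C> \<and> card \<C> \<le> j \<and> B \<subseteq> \<Union>\<C> \<and>
          \<C> \<subseteq> {mcball_of m x \<rho> | x \<rho>. x \<in> mspace m \<and> 0 < \<rho> \<and> \<rho> \<le> r'}" by (intro exI[of _ \<C>]) blast
  qed
  then obtain \<C> where \<C>: "\<forall>B\<in>\<B>. finite (\<C> B) \<and> card (\<C> B) \<le> j \<and> B \<subseteq> \<Union>(\<C> B) \<and>
          \<C> B \<subseteq> {mcball_of m x \<rho> | x \<rho>. x \<in> mspace m \<and> 0 < \<rho> \<and> \<rho> \<le> r'}" ..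
  have "covering_number m r' E \<le> enat (card (\<Union>(\<C> ` \<B>)))"
    unfolding covering_number_def
  proof (rule INF_lower, rule CollectI, intro conjI)
    show "finite (\<Union>(\<C> ` \<B>))" using \<B>(1) \<C> by simp
    show "\<Union>(\<C> ` \<B>) \<subseteq> {mcball_of m x \<rho> | x \<rho>. x \<in> mspace m \<and> 0 < \<rho> \<and> \<rho> \<le> r'}"
      using \<C> by (intro UN_least) auto
    show "E \<subseteq> \<Union> (\<Union> (\<C> ` \<B>))"
    proof
      fix x assume "x \<in> E"
      then obtain B where "B \<in> \<B>" "x \<in> B" using \<B>(3) by auto
      moreover have "B \<subseteq> \<Union>(\<C> B)" using \<C> \<open>B \<in> \<B>\<close> by simp
      ultimately show "x \<in> \<Union> (\<Union> (\<C> ` \<B>))" by blast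
    qed
  qed
  also have "card (\<Union>(\<C> ` \<B>)) \<le> (\<Sum>B\<in>\<B>. card (\<C> B))" using \<B>(1) by (rule card_UN_le)
  also have "\<dots> \<le> (\<Sum>B\<in>\<B>. j)" using \<C> by (intro sum_mono) auto
  also have "\<dots> \<le> k * j" using \<B>(2) by simp
  finally show ?thesis by simp
qed

text \<open>One ball per descendant of \<open>v\<close> at level \<open>l\<close> suffices, since
  rays through a common node of level \<open>l\<close> are within distance \<open>r\<close>.\<close>

lemma covering_number_cylinder_le:
  assumes "0 < r" "2 powr - real l \<le> r" "k \<le> l" "v \<in> tree c" "length v = k"
    and E: "E \<subseteq> {y \<in> rays (tree c). y k = v}"
  shows "covering_number (gromov_boundary (tree c)) r E \<le> enat (generation (l - k) (shift v c))"
proof -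
  let ?D = "{u \<in> tree (shift v c). length u = l - k}"
  \<comment> \<open>The nodes of level \<open>l\<close> that lie on a ray of \<open>E\<close>. Balls
    must be centred at rays, so dead branches are left out.\<close>
  let ?L = "(\<lambda>y. y l) ` E"
  have L: "?L \<subseteq> (\<lambda>u. v @ u) ` ?D"
  proof safe
    fix y assume "y \<in> E"
    then have y: "y \<in> rays (tree c)" "y k = v" using E by auto
    obtain u where u: "y l = v @ u" "length u = l - k" using ray_append[OF y(1) \<open>k \<le> l\<close>] y(2) by auto
    then have "u \<in> tree (shift v c)" using ray_in_tree[OF y(1), of l] by (simp add: tree_append_iff)
    with u show "y l \<in> (\<lambda>u. v @ u) ` ?D" by auto
  qed
  have fin: "finite ?L" by (rule finite_subset[OF L]) (use card_generation in auto)
  have "\<forall>w\<in>?L. \<exists>y. y \<in> E \<and> y l = w" by auto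
  from bchoice[OF this] obtain g where g: "\<And>w. w \<in> ?L \<Longrightarrow> g w \<in> E \<and> g w l = w" by blast
  have "covering_number (gromov_boundary (tree c)) r E \<le> enat (card ?L)"
  proof (rule covering_number_le[OF fin \<open>0 < r\<close>])
    show "g w \<in> mspace (gromov_boundary (tree c))" if "w \<in> ?L" for w using g[OF that] E by auto
    show "E \<subseteq> (\<Union>w\<in>?L. mcball_of (gromov_boundary (tree c)) (g w) r)"
    proof
      fix y assume y: "y \<in> E"
      then have gy: "g (y l) \<in> E" "g (y l) l = y l" using g[of "y l"] by auto
      then have "ray_dist (g (y l)) y \<le> 2 powr - real l"
        using y E by (subst ray_dist_le_iff) auto
      then show "y \<in> (\<Union>w\<in>?L. mcball_of (gromov_boundary (tree c)) (g w) r)"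
        using y gy E assms(2) by (intro UN_I[of "y l"]) auto
    qed
  qed
  also have "card ?L \<le> card ?D"
  proof -
    have "finite ?D" using card_generation by blast
    then show ?thesis using card_mono[OF _ L] card_image_le order_trans by blast
  qed
  finally show ?thesis using card_generation[of "shift v c" "l - k"] by simp
qed

lemma covering_number_ball_le:
  assumes "0 < r" "2 powr - real l \<le> r" "k \<le> l" "R \<le> 2 powr - real k" "x \<in> rays (tree c)"
  shows "covering_number (gromov_boundary (tree c)) r (mcball_of (gromov_boundary (tree c)) x R)
       \<le> enat (generation (l - k) (shift (x k) c))"
proof (rule covering_number_cylinder_le[OF assms(1-3)])
  show "mcball_of (gromov_boundary (tree c)) x R \<subseteq> {y \<in> rays (tree c). y k = x k}"
  proof safe
    fix y assume "y \<in> mcball_of (gromov_boundary (tree c)) x R"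
    then have y: "y \<in> rays (tree c)" "ray_dist x y \<le> 2 powr - real k" using assms(4) by auto
    then show "y \<in> rays (tree c)" "y k = x k" using ray_dist_le_iff[OF assms(5), of y k] by auto
  qed
qed (use assms(5) in \<open>auto intro: ray_length ray_in_tree\<close>)

lemma covering_number_rays_le:
  assumes "0 < r" "2 powr - real l \<le> r" "E \<subseteq> rays (tree c)"
  shows "covering_number (gromov_boundary (tree c)) r E \<le> enat (generation l c)"
  using covering_number_cylinder_le[of r l 0 "[]" c E] assms by (auto simp: rays_def)

text \<open>Weak duality of flows and cuts: \<open>p ^ length v * (1 - cut_prob_lim p (shift v c))\<close> is at most
  the sum of its values at the children of \<open>v\<close>. The ray is built greedily, through nodes whose flow
  exceeds the total weight of the \<open>f i\<close> below them.\<close>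

lemma ray_avoiding:
  assumes p: "0 < p" "p < 1"
    and less: "(\<integral>\<^sup>+i. ennreal (p ^ length (f i)) \<partial>count_space I) < ennreal (1 - cut_prob_lim p c)"
  obtains x where "x \<in> rays (tree c)" "\<And>i n. i \<in> I \<Longrightarrow> x n \<noteq> f i"
proof -
  \<comment> \<open>For a node \<open>v\<close>, \<open>q v\<close> is the probability given the
    tree that the path to \<open>v\<close> is open and \<open>v\<close> survives;
    \<open>\<mu> v\<close> is the total weight of the \<open>f i\<close> at or below
    \<open>v\<close>. The greedy ray keeps \<open>J\<close> invariant.\<close>
  define q where "q v = p ^ length v * (1 - cut_prob_lim p (shift v c))" for v
  define \<mu> where "\<mu> v = (\<integral>\<^sup>+i. ennreal (p ^ length (f i)) * indicator {i. take (length v) (f i) = v} i \<partial>count_space I)" for v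
  define J where "J v \<longleftrightarrow> v \<in> tree c \<and> \<mu> v < ennreal (q v)" for v
  have q0: "0 \<le> q v" for v using p cut_prob_lim_bounds[OF p] by (simp add: q_def)
  have q_rec: "q v \<le> (\<Sum>i<c v. q (v @ [i]))" for v
    using mult_left_mono[OF one_minus_cut_prob_lim_le[OF p, of "shift v c"], of "p ^ length v"] p
    by (simp add: q_def shift_shift sum_distrib_left mult_ac)
  \<comment> \<open>Distinct children have disjoint sets of descendants, so each \<open>f i\<close>
    is counted at most once. Equality can fail, for instance when \<open>v\<close> itself is some
    \<open>f i\<close>.\<close>
  have \<mu>_rec: "(\<Sum>j<c v. \<mu> (v @ [j])) \<le> \<mu> v" for v
  proof -
    have "(\<Sum>j<c v. \<mu> (v @ [j])) = (\<integral>\<^sup>+i. (\<Sum>j<c v. ennreal (p ^ length (f i)) * indicator {i. take (length (v @ [j])) (f i) = v @ [j]} i) \<partial>count_space I)"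
      unfolding \<mu>_def by (subst nn_integral_sum) auto
    also have "\<dots> \<le> \<mu> v"
      unfolding \<mu>_def
    proof (rule nn_integral_mono)
      fix i
      let ?h = "\<lambda>j. ennreal (p ^ length (f i)) * indicator {i. take (length (v @ [j])) (f i) = v @ [j]} i"
      show "(\<Sum>j<c v. ?h j) \<le> ennreal (p ^ length (f i)) * indicator {i. take (length v) (f i) = v} i"
      proof (cases "\<exists>j<c v. take (length (v @ [j])) (f i) = v @ [j]")
        case True
        then obtain j where j: "j < c v" "take (length (v @ [j])) (f i) = v @ [j]" by blast
        have "take (length v) (take (length (v @ [j])) (f i)) = v" using j by simp
        then have tv: "take (length v) (f i) = v" by simp
        have "sum ?h {..<c v} = sum ?h {j}"
          using j by (intro sum.mono_neutral_right) (auto simp: indicator_def)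
        also have "\<dots> = ?h j" by (subst sum.insert) auto
        also have "\<dots> \<le> ennreal (p ^ length (f i)) * indicator {i. take (length v) (f i) = v} i"
          using tv by (simp add: indicator_def)
        finally show ?thesis .
      next
        case False
        then have "sum ?h {..<c v} = 0" by (intro sum.neutral) (auto simp: indicator_def)
        then show ?thesis by (rule ord_eq_le_trans) simp
      qed
    qed
    finally show ?thesis .
  qed
  have child: "\<exists>j. J (v @ [j])" if "J v" for v
  proof (rule ccontr)
    assume no: "\<not> ?thesis"
    have "ennreal (q v) \<le> ennreal (\<Sum>j<c v. q (v @ [j]))" by (intro ennreal_leI q_rec)
    also have "\<dots> = (\<Sum>j<c v. ennreal (q (v @ [j])))" using q0 by simp
    also have "\<dots> \<le> (\<Sum>j<c v. \<mu> (v @ [j]))"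
    proof (rule sum_mono)
      fix j assume "j \<in> {..<c v}"
      then have "v @ [j] \<in> tree c" using that by (simp add: J_def tree_snoc_iff)
      then show "ennreal (q (v @ [j])) \<le> \<mu> (v @ [j])" using no by (auto simp: J_def not_less)
    qed
    also have "\<dots> \<le> \<mu> v" by (rule \<mu>_rec)
    finally show False using that unfolding J_def by (meson leD)
  qed
  have "J []" using less by (simp add: J_def \<mu>_def q_def)
  then have "\<exists>x. \<forall>n. (J (x n) \<and> (n = 0 \<longrightarrow> x n = [])) \<and> (\<exists>j. x (Suc n) = x n @ [j])"
    using child by (intro dependent_nat_choice) auto
  then obtain x where x: "\<And>n. J (x n)" "x 0 = []" "\<And>n. \<exists>j. x (Suc n) = x n @ [j]" by auto
  show thesis
  proof
    show "x \<in> rays (tree c)" using x by (auto simp: rays_def J_def)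
    \<comment> \<open>If the ray hit \<open>f i\<close>, the weight of \<open>i\<close> alone would
      be at least the flow there, which is at most \<open>p ^ length (f i)\<close>, contrary to
      \<open>J (x n)\<close>.\<close>
    show "x n \<noteq> f i" if "i \<in> I" for i n
    proof
      assume eq: "x n = f i"
      have "ennreal (p ^ length (f i)) \<le> \<mu> (x n)"
        unfolding \<mu>_def using nn_integral_ge_point[OF that, of "\<lambda>i. ennreal (p ^ length (f i)) * indicator {i. take (length (x n)) (f i) = x n} i"] eq
        by (simp add: indicator_def)
      also have "\<dots> < ennreal (q (x n))" using x(1)[of n] by (simp add: J_def)
      also have "\<dots> \<le> ennreal (p ^ length (f i))"
        unfolding q_def eq using p cut_prob_lim_bounds[OF p] by (intro ennreal_leI mult_left_le) auto
      finally show False by simp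
    qed
  qed
qed

text \<open>A ball of radius at most \<open>2 powr - real n\<close> lies below one node of level
  \<open>n\<close>, of weight \<open>p ^ n\<close>. If these nodes weighed too little in total, some
  ray would avoid all of them.\<close>

lemma covering_number_ge:
  assumes p: "0 < p" "p < 1" and r: "r \<le> 2 powr - real n"
    and cov: "covering_number (gromov_boundary (tree c)) r (rays (tree c)) \<le> enat k"
  shows "1 - cut_prob_lim p c \<le> real k * p ^ n"
proof (rule ccontr)
  assume less: "\<not> ?thesis"
  obtain \<B> where \<B>: "finite \<B>" "card \<B> \<le> k" "rays (tree c) \<subseteq> \<Union>\<B>"
    "\<And>B. B \<in> \<B> \<Longrightarrow> \<exists>x \<rho>. B = mcball_of (gromov_boundary (tree c)) x \<rho> \<and> x \<in> mspace (gromov_boundary (tree c)) \<and> 0 < \<rho> \<and> \<rho> \<le> r"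
    by (rule covering_numberE[OF cov]) blast
  have "\<exists>f. \<forall>B\<in>\<B>. length (f B) = n \<and> (\<forall>y\<in>B. y n = f B)"
  proof (rule bchoice, rule ballI)
    fix B assume mem: "B \<in> \<B>"
    obtain x \<rho> where x: "B = mcball_of (gromov_boundary (tree c)) x \<rho>" "x \<in> rays (tree c)" "\<rho> \<le> r"
      using \<B>(4)[OF mem] by auto
    have "y n = x n" if "y \<in> B" for y
      using that x r ray_dist_le_iff[of x "tree c" y n] by auto
    then show "\<exists>w. length w = n \<and> (\<forall>y\<in>B. y n = w)" using ray_length[OF x(2)] by blast
  qed
  then obtain f where f: "\<forall>B\<in>\<B>. length (f B) = n \<and> (\<forall>y\<in>B. y n = f B)" ..
  have "(\<integral>\<^sup>+B. ennreal (p ^ length (f B)) \<partial>count_space \<B>) = (\<Sum>B\<in>\<B>. ennreal (p ^ n))"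
    using \<B>(1) f by (subst nn_integral_count_space_finite) auto
  also have "\<dots> = ennreal (real (card \<B>) * p ^ n)"
    using p by (simp add: ennreal_mult ennreal_of_nat_eq_real_of_nat)
  also have "\<dots> < ennreal (1 - cut_prob_lim p c)"
  proof (rule ennreal_lessI)
    have "real (card \<B>) * p ^ n \<le> real k * p ^ n" "0 \<le> real k * p ^ n"
      using p \<B>(2) by (auto intro!: mult_right_mono)
    with less show "real (card \<B>) * p ^ n < 1 - cut_prob_lim p c" "0 < 1 - cut_prob_lim p c" by linarith+
  qed
  finally obtain x where "x \<in> rays (tree c)" "\<And>B n. B \<in> \<B> \<Longrightarrow> x n \<noteq> f B"
    by (rule ray_avoiding[OF p]) blast
  with \<B>(3) f show False by blast
qed

section \<open>Hausdorff and box dimension\<close>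

lemma two_powr_floor:
  assumes "0 < r" "r \<le> 1"
  shows "r \<le> 2 powr - real (nat \<lfloor>- ln r / ln 2\<rfloor>)" "- ln r / ln 2 - 1 \<le> real (nat \<lfloor>- ln r / ln 2\<rfloor>)"
proof -
  have 0: "0 \<le> - ln r / ln 2" using assms by (intro divide_nonneg_pos) auto
  then have n: "real (nat \<lfloor>- ln r / ln 2\<rfloor>) \<le> - ln r / ln 2" by simp
  have "r = 2 powr (ln r / ln 2)" using assms by (simp add: powr_def)
  also have "\<dots> \<le> 2 powr - real (nat \<lfloor>- ln r / ln 2\<rfloor>)" using n by (intro powr_mono) auto
  finally show "r \<le> 2 powr - real (nat \<lfloor>- ln r / ln 2\<rfloor>)" .
  show "- ln r / ln 2 - 1 \<le> real (nat \<lfloor>- ln r / ln 2\<rfloor>)" using 0 by linarith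
qed

lemma two_powr_ceiling:
  assumes "0 < r" "- ln r / ln 2 \<le> real l"
  shows "2 powr - real l \<le> r"
proof -
  have "2 powr - real l \<le> 2 powr (ln r / ln 2)" using assms(2) by (intro powr_mono) auto
  also have "\<dots> = r" using assms by (simp add: powr_def)
  finally show ?thesis .
qed

text \<open>Cover by the cylinders of level \<open>n\<close>: their \<open>s\<close>-sum is at most
  \<open>(b * 2 powr - s) ^ n\<close>, which tends to \<open>0\<close> when
  \<open>s > log 2 b\<close>.\<close>

lemma hausdorff_dim_le:
  assumes b: "1 < b" and gen: "\<forall>\<^sub>F n in sequentially. real (generation n c) \<le> b ^ n"
  shows "hausdorff_dim (gromov_boundary (tree c)) \<le> ereal (log 2 b)"
proof (rule ereal_le_epsilon2)
  fix e :: real assume e: "0 < e"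
  let ?G = "gromov_boundary (tree c)"
  define s where "s = log 2 b + e"
  have s: "0 < s" using b e by (simp add: s_def add_pos_pos)
  define t where "t = b * 2 powr - s"
  have t: "0 < t" "t < 1"
  proof -
    have "b = 2 powr log 2 b" using b by simp
    also have "\<dots> < 2 powr s" using e by (intro powr_less_mono) (auto simp: s_def)
    finally show "t < 1" by (simp add: t_def powr_minus field_simps)
  qed (use b in \<open>simp add: t_def\<close>)
  have "hausdorff_premeasure ?G s \<delta> (rays (tree c)) = 0" if \<delta>: "0 < \<delta>" for \<delta>
  proof -
    have "((\<lambda>n. (1/2 :: real) ^ n) \<longlongrightarrow> 0) sequentially" by (intro LIMSEQ_power_zero) auto
    from order_tendstoD(2)[OF this \<delta>] have "\<forall>\<^sub>F n in sequentially. (1/2) ^ n < \<delta>" .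
    with gen have "\<forall>\<^sub>F n in sequentially. hausdorff_premeasure ?G s \<delta> (rays (tree c)) \<le> ennreal (t ^ n)"
    proof eventually_elim
      case (elim n)
      let ?L = "{u \<in> tree c. length u = n}"
      have half: "2 powr - real n = (1/2) ^ n"
        by (simp add: powr_minus powr_realpow power_divide field_simps)
      obtain h where h: "bij_betw h {0..<card ?L} ?L"
        using ex_bij_betw_nat_finite card_generation by blast
      \<comment> \<open>Covers are sequences, so the enumeration is padded with empty sets, which
        contribute nothing because \<open>0 powr s = 0\<close>.\<close>
      define U where "U i = (if i < card ?L then {y \<in> rays (tree c). y n = h i} else {})" for i
      have diam: "mdiameter ?G (U i) \<le> ennreal (2 powr - real n)" for i
        unfolding mdiameter_def U_def
        by (auto intro!: SUP_least ennreal_leI simp: ray_dist_le_iff)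
      have "hausdorff_premeasure ?G s \<delta> (rays (tree c)) \<le> (\<Sum>i. ennreal (enn2real (mdiameter ?G (U i)) powr s))"
        unfolding hausdorff_premeasure_def
      proof (rule INF_lower, rule CollectI, intro conjI allI)
        show "U i \<subseteq> mspace ?G" for i by (auto simp: U_def)
        show "mdiameter ?G (U i) \<le> ennreal \<delta>" for i
          using order_trans[OF diam[of i] ennreal_leI[of "2 powr - real n" \<delta>]] elim(2) by (simp add: half)
        show "rays (tree c) \<subseteq> (\<Union>i. U i)"
        proof
          fix x assume x: "x \<in> rays (tree c)"
          then have "x n \<in> ?L" by (simp add: ray_in_tree ray_length)
          then have "x n \<in> h ` {0..<card ?L}" using bij_betw_imp_surj_on[OF h] by (simp only:)
          then obtain i where "i < card ?L" "h i = x n" by auto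
          with x have "x \<in> U i" by (simp add: U_def)
          then show "x \<in> (\<Union>i. U i)" by blast
        qed
      qed
      also have "\<dots> = (\<Sum>i<card ?L. ennreal (enn2real (mdiameter ?G (U i)) powr s))"
        using s by (intro suminf_finite) (auto simp: U_def mdiameter_def bot_ennreal)
      also have "\<dots> \<le> (\<Sum>i<card ?L. ennreal ((2 powr - real n) powr s))"
      proof (intro sum_mono ennreal_leI powr_mono2)
        show "enn2real (mdiameter ?G (U i)) \<le> 2 powr - real n" for i
          using diam[of i] by (intro enn2real_leI) auto
      qed (use s in auto)
      also have "\<dots> = ennreal (real (generation n c) * (2 powr - real n) powr s)"
        using card_generation[of c n] by (simp add: ennreal_mult ennreal_of_nat_eq_real_of_nat)
      also have "\<dots> \<le> ennreal (b ^ n * (2 powr - real n) powr s)"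
        using elim(1) by (intro ennreal_leI mult_right_mono) auto
      also have "b ^ n * (2 powr - real n) powr s = t ^ n"
        by (simp add: t_def power_mult_distrib powr_powr powr_power mult.commute)
      finally show ?case .
    qed
    moreover have "(\<lambda>n. ennreal (t ^ n)) \<longlonglongrightarrow> ennreal 0"
      using t by (intro tendsto_ennrealI LIMSEQ_power_zero) auto
    ultimately have "hausdorff_premeasure ?G s \<delta> (rays (tree c)) \<le> ennreal 0"
      by (intro tendsto_le[OF _ _ tendsto_const]) auto
    then show ?thesis by simp
  qed
  then have "hausdorff_measure ?G s (mspace ?G) = 0"
    by (simp add: hausdorff_measure_def SUP_eq_const[of "{0<..}"])
  then have "hausdorff_dim ?G \<le> ereal s"
    unfolding hausdorff_dim_def using s by (intro INF_lower) auto
  then show "hausdorff_dim ?G \<le> ereal (log 2 b) + ereal e" by (simp add: s_def)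
qed

text \<open>For \<open>s < - log 2 p\<close>, a set of diameter \<open>d\<close> in
  \<open>(0, 1]\<close> lies below a node of weight at most \<open>2 powr s * d powr s\<close>. A
  cover with small \<open>s\<close>-sum would give blocking nodes of total weight below the survival
  probability.\<close>

lemma hausdorff_dim_ge:
  assumes p: "0 < p" "p < 1" and q: "cut_prob_lim p c < 1"
  shows "ereal (- log 2 p) \<le> hausdorff_dim (gromov_boundary (tree c))"
  unfolding hausdorff_dim_def
proof (rule INF_greatest, rule ccontr)
  let ?G = "gromov_boundary (tree c)"
  fix s assume s: "s \<in> {s. 0 < s \<and> hausdorff_measure ?G s (mspace ?G) = 0}" "\<not> ereal (- log 2 p) \<le> ereal s"
  then have s0: "0 < s" and s1: "s < - log 2 p" and H0: "hausdorff_measure ?G s (rays (tree c)) = 0"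
    by auto
  have p_le: "p \<le> 2 powr - s"
  proof -
    have "p = 2 powr (log 2 p)" using p by simp
    also have "\<dots> \<le> 2 powr - s" using s1 by (intro powr_mono) auto
    finally show ?thesis .
  qed
  define q where "q = 1 - cut_prob_lim p c"
  have q0: "0 < q" using q by (simp add: q_def)
  \<comment> \<open>Small enough that \<open>2 powr s * \<epsilon>\<close> from the diameters and
    \<open>\<epsilon>\<close> from the geometric corrections add up to \<open>q / 2\<close>.\<close>
  define \<epsilon> where "\<epsilon> = q / (2 * (2 powr s + 1))"
  have \<epsilon>: "0 < \<epsilon>" "2 powr s * \<epsilon> + \<epsilon> < q"
  proof -
    have pos: "0 < 2 powr s + 1" by (simp add: add_pos_pos)
    with q0 show "0 < \<epsilon>" by (simp add: \<epsilon>_def)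
    have "2 powr s * \<epsilon> + \<epsilon> = (2 powr s + 1) * \<epsilon>" by (simp add: algebra_simps)
    also have "K * (q / (2 * K)) = q / 2" if "0 < K" for K using that by simp
    then have "(2 powr s + 1) * \<epsilon> = q / 2" using pos by (simp only: \<epsilon>_def)
    finally show "2 powr s * \<epsilon> + \<epsilon> < q" using q0 by simp
  qed
  have "hausdorff_premeasure ?G s 1 (rays (tree c)) \<le> hausdorff_measure ?G s (rays (tree c))"
    unfolding hausdorff_measure_def by (rule SUP_upper) simp
  then have "hausdorff_premeasure ?G s 1 (rays (tree c)) < ennreal \<epsilon>" using H0 \<epsilon> by simp
  then obtain U where U: "\<And>i. U i \<subseteq> rays (tree c)" "\<And>i. mdiameter ?G (U i) \<le> ennreal 1"
    "rays (tree c) \<subseteq> (\<Union>i. U i)" "(\<Sum>i. ennreal (enn2real (mdiameter ?G (U i)) powr s)) < ennreal \<epsilon>"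
    unfolding hausdorff_premeasure_def INF_less_iff by auto
  define d where "d i = enn2real (mdiameter ?G (U i))" for i :: nat
  have d: "0 \<le> d i" "mdiameter ?G (U i) = ennreal (d i)" "d i \<le> 1" for i
  proof -
    have "mdiameter ?G (U i) \<noteq> \<top>" using U(2)[of i] by (auto simp: top_unique)
    then show "mdiameter ?G (U i) = ennreal (d i)" by (simp add: d_def less_top)
    show "d i \<le> 1" unfolding d_def using U(2)[of i] by (intro enn2real_leI) auto
  qed (simp add: d_def)
  \<comment> \<open>Sets of diameter \<open>0\<close> have no natural level: a node deep enough is
    chosen, and the summable term in \<open>\<epsilon>\<close> pays for its weight.\<close>
  have "\<exists>w. \<forall>i. (\<forall>y\<in>U i. y (length (w i)) = w i) \<and> p ^ length (w i) \<le> 2 powr s * d i powr s + \<epsilon> * (1/2) ^ Suc i"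
  proof (rule choice, rule allI)
    fix i
    have n: "\<exists>n. d i \<le> 2 powr - real n \<and> p ^ n \<le> 2 powr s * d i powr s + \<epsilon> * (1/2) ^ Suc i"
    proof (cases "d i = 0")
      case True
      have "(\<lambda>n. p ^ n) \<longlonglongrightarrow> 0" using p by (intro LIMSEQ_power_zero) auto
      from order_tendstoD(2)[OF this, of "\<epsilon> * (1/2) ^ Suc i"] \<epsilon>
      have "\<forall>\<^sub>F n in sequentially. p ^ n < \<epsilon> * (1/2) ^ Suc i" by simp
      then obtain n where "p ^ n < \<epsilon> * (1/2) ^ Suc i" by (metis eventually_happens' sequentially_bot)
      then show ?thesis using True by (intro exI[of _ n]) simp
    next
      case False
      then have di: "0 < d i" "d i \<le> 1" using d[of i] by auto
      define n where "n = nat \<lfloor>- ln (d i) / ln 2\<rfloor>"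
      have n: "d i \<le> 2 powr - real n" "- ln (d i) / ln 2 - 1 \<le> real n"
        unfolding n_def using two_powr_floor[OF di] by auto
      have "p ^ n \<le> (2 powr - s) ^ n" using p p_le by (intro power_mono) auto
      also have "\<dots> = 2 powr (- s * real n)" by (simp add: powr_power mult.commute)
      also have "\<dots> \<le> 2 powr (s + s * (ln (d i) / ln 2))"
        using mult_left_mono[OF n(2), of s] s0 by (intro powr_mono) (auto simp: algebra_simps)
      also have "\<dots> = 2 powr s * d i powr s"
        using di by (simp add: powr_add) (simp add: powr_def)
      finally show ?thesis using n \<epsilon> by (intro exI[of _ n]) (simp add: add_increasing2)
    qed
    then obtain n where n: "d i \<le> 2 powr - real n" "p ^ n \<le> 2 powr s * d i powr s + \<epsilon> * (1/2) ^ Suc i"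
      by blast
    show "\<exists>w. (\<forall>y\<in>U i. y (length w) = w) \<and> p ^ length w \<le> 2 powr s * d i powr s + \<epsilon> * (1/2) ^ Suc i"
    proof (cases "U i = {}")
      \<comment> \<open>The empty set imposes no condition on the node, so any word of the right
        length serves.\<close>
      case True
      then show ?thesis using n(2) by (intro exI[of _ "replicate n 0"]) auto
    next
      case False
      then obtain x where x: "x \<in> U i" by blast
      have "\<forall>y\<in>U i. y n = x n"
      proof
        fix y assume y: "y \<in> U i"
        have "ennreal (ray_dist x y) \<le> mdiameter ?G (U i)"
          unfolding mdiameter_def by (rule SUP_upper2[OF x], rule SUP_upper2[OF y]) simp
        then have "ray_dist x y \<le> d i" using d[of i] by simp
        then have "ray_dist x y \<le> 2 powr - real n" using n(1) by simp
        moreover have "x \<in> rays (tree c)" "y \<in> rays (tree c)" using x y U(1) by auto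
        ultimately show "y n = x n" using ray_dist_le_iff[of x "tree c" y n] by simp
      qed
      moreover have "length (x n) = n" using x U(1) by (auto intro: ray_length)
      ultimately show ?thesis using n(2) by (intro exI[of _ "x n"]) (simp only: simp_thms)
    qed
  qed
  then obtain w where W: "\<forall>i. (\<forall>y\<in>U i. y (length (w i)) = w i) \<and> p ^ length (w i) \<le> 2 powr s * d i powr s + \<epsilon> * (1/2) ^ Suc i" ..
  note w = W[THEN spec, THEN conjunct1] W[THEN spec, THEN conjunct2]
  have "(\<integral>\<^sup>+i. ennreal (p ^ length (w i)) \<partial>count_space UNIV) = (\<Sum>i. ennreal (p ^ length (w i)))"
    by (rule nn_integral_count_space_nat)
  also have "\<dots> \<le> (\<Sum>i. ennreal (2 powr s) * ennreal (d i powr s) + ennreal \<epsilon> * ennreal ((1/2) ^ Suc i))"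
  proof (rule suminf_le)
    show "ennreal (p ^ length (w i)) \<le> ennreal (2 powr s) * ennreal (d i powr s) + ennreal \<epsilon> * ennreal ((1/2) ^ Suc i)" for i
      using ennreal_leI[OF w(2)[of i]] \<epsilon> by (simp add: ennreal_plus ennreal_mult del: power_Suc)
  qed auto
  also have "\<dots> = ennreal (2 powr s) * (\<Sum>i. ennreal (d i powr s)) + ennreal \<epsilon> * (\<Sum>i. ennreal ((1/2) ^ Suc i))"
    by (subst suminf_add[symmetric]) (auto simp: ennreal_suminf_cmult)
  also have "(\<Sum>i. ennreal ((1/2 :: real) ^ Suc i)) = ennreal 1"
    by (rule suminf_ennreal_eq[OF _ power_half_series]) auto
  also have "ennreal (2 powr s) * (\<Sum>i. ennreal (d i powr s)) + ennreal \<epsilon> * ennreal 1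
      \<le> ennreal (2 powr s) * ennreal \<epsilon> + ennreal \<epsilon> * ennreal 1"
    using U(4) by (intro add_right_mono mult_left_mono) (auto simp: d_def)
  also have "\<dots> = ennreal (2 powr s * \<epsilon> + \<epsilon>)" using \<epsilon> by (simp add: ennreal_mult)
  also have "\<dots> < ennreal (1 - cut_prob_lim p c)"
    using \<epsilon> q0 by (intro ennreal_lessI) (auto simp: q_def)
  finally obtain x where x: "x \<in> rays (tree c)" "\<And>i n. i \<in> UNIV \<Longrightarrow> x n \<noteq> w i"
    by (rule ray_avoiding[OF p]) blast
  then obtain i where "x \<in> U i" using U(3) by blast
  with w(1)[of i] have "x (length (w i)) = w i" by (rule bspec)
  with x(2)[OF UNIV_I] show False by (rule notE)
qed

text \<open>Cover by cylinders of level about \<open>- log 2 r\<close>; rounding the level up costs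
  one generation, which vanishes against \<open>- ln r\<close>.\<close>

lemma upper_box_dim_le:
  assumes b: "1 < b" and gen: "\<forall>\<^sub>F n in sequentially. real (generation n c) \<le> b ^ n"
  shows "upper_box_dim (gromov_boundary (tree c)) \<le> ereal (log 2 b)"
proof -
  let ?G = "gromov_boundary (tree c)"
  define h where "h r = (- ln r / ln 2 + 1) * ln b / (- ln r)" for r :: real
  have h_lim: "(h \<longlongrightarrow> inverse (ln 2) * ln b) (at_right 0)"
    unfolding h_def by real_asymp
  have "filterlim (\<lambda>r. nat \<lceil>- ln r / ln 2\<rceil>) sequentially (at_right (0::real))"
    by real_asymp
  from eventually_compose_filterlim[OF gen this]
  have "\<forall>\<^sub>F r::real in at_right 0. real (generation (nat \<lceil>- ln r / ln 2\<rceil>) c) \<le> b ^ nat \<lceil>- ln r / ln 2\<rceil>" .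
  moreover have "\<forall>\<^sub>F r in at_right 0. 0 < r \<and> r < (1::real)"
    by (intro eventually_conj eventually_at_right_less eventually_at_rightI[of 0 1]) auto
  ultimately have "\<forall>\<^sub>F r in at_right 0. ln_enat (covering_number ?G r (mspace ?G)) / ereal (- ln r) \<le> ereal (h r)"
  proof eventually_elim
    case (elim r)
    define l where "l = nat \<lceil>- ln r / ln 2\<rceil>"
    have r: "0 < r" "r < 1" and l0: "0 < - ln r" using elim(2) by auto
    have "0 \<le> - ln r / ln 2" using l0 by (intro divide_nonneg_pos) auto
    then have lr: "- ln r / ln 2 \<le> real l" "real l \<le> - ln r / ln 2 + 1"
      unfolding l_def by linarith+
    have "covering_number ?G r (rays (tree c)) \<le> enat (generation l c)"
      using r lr by (intro covering_number_rays_le two_powr_ceiling) auto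
    then obtain k where k: "covering_number ?G r (rays (tree c)) = enat k" "k \<le> generation l c"
      by (cases "covering_number ?G r (rays (tree c))") auto
    show ?case
    proof (cases "k = 0")
      case True
      then show ?thesis using l0 by (simp add: k(1) ln_enat_def)
    next
      case False
      have "real k \<le> b ^ l" using k(2) elim(1) by (simp add: l_def) 
      then have "ln (real k) \<le> ln (b ^ l)" using False b by (subst ln_le_cancel_iff) auto
      also have "\<dots> = real l * ln b" using b by (simp add: ln_realpow)
      also have "\<dots> \<le> (- ln r / ln 2 + 1) * ln b" using lr(2) b by (intro mult_right_mono) auto
      finally have "ln (real k) / (- ln r) \<le> h r" unfolding h_def using l0 by (intro divide_right_mono) auto
      then show ?thesis using False l0 by (simp add: k(1) ln_enat_def)
    qed
  qed
  then have "upper_box_dim ?G \<le> Limsup (at_right 0) (\<lambda>r. ereal (h r))"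
    unfolding upper_box_dim_def by (rule Limsup_mono)
  also have "\<dots> = ereal (inverse (ln 2) * ln b)"
    by (rule lim_imp_Limsup) (use h_lim in auto)
  finally show ?thesis by (simp add: log_def field_simps)
qed

text \<open>A cover by \<open>k\<close> balls satisfies
  \<open>1 - cut_prob_lim p c \<le> k * p ^ n\<close> with \<open>n\<close> the level of the scale
  \<open>r\<close>; the constant and the rounding vanish after division by
  \<open>- ln r\<close>.\<close>

lemma lower_box_dim_ge:
  assumes p: "0 < p" "p < 1" and q: "cut_prob_lim p c < 1"
  shows "ereal (- log 2 p) \<le> lower_box_dim (gromov_boundary (tree c))"
proof -
  let ?G = "gromov_boundary (tree c)"
  define q where "q = 1 - cut_prob_lim p c"
  have q0: "0 < q" using q by (simp add: q_def)
  define h where "h r = (ln q + (- ln r / ln 2 - 1) * (- ln p)) / (- ln r)" for r :: real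
  have h_lim: "(h \<longlongrightarrow> - (inverse (ln 2) * ln p)) (at_right 0)"
    unfolding h_def by real_asymp
  have "\<forall>\<^sub>F r in at_right 0. 0 < r \<and> r < (1::real)"
    by (intro eventually_conj eventually_at_right_less eventually_at_rightI[of 0 1]) auto
  then have "\<forall>\<^sub>F r in at_right 0. ereal (h r) \<le> ln_enat (covering_number ?G r (mspace ?G)) / ereal (- ln r)"
  proof eventually_elim
    case (elim r)
    define n where "n = nat \<lfloor>- ln r / ln 2\<rfloor>"
    have r: "0 < r" "r < 1" and l0: "0 < - ln r" using elim by auto
    have n: "r \<le> 2 powr - real n" "- ln r / ln 2 - 1 \<le> real n"
      unfolding n_def using two_powr_floor[of r] r by auto
    show ?case
    proof (cases "covering_number ?G r (rays (tree c))")
      case (enat k)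
      then have "q \<le> real k * p ^ n"
        unfolding q_def using covering_number_ge[OF p n(1), of c k] by simp
      then have k: "0 < real k" "ln q \<le> ln (real k * p ^ n)"
        using q0 by (auto intro!: gr0I)
      then have "ln q + real n * (- ln p) \<le> ln (real k)"
        using p by (simp add: ln_mult ln_realpow)
      moreover have "(- ln r / ln 2 - 1) * (- ln p) \<le> real n * (- ln p)"
        using n(2) p by (intro mult_right_mono) auto
      ultimately have "h r \<le> ln (real k) / (- ln r)"
        unfolding h_def using l0 by (intro divide_right_mono) auto
      then show ?thesis using k l0 by (simp add: enat ln_enat_def)
    next
      case infinity
      then show ?thesis using l0 by (simp add: ln_enat_def)
    qed
  qed
  then have "Liminf (at_right 0) (\<lambda>r. ereal (h r)) \<le> lower_box_dim ?G"
    unfolding lower_box_dim_def by (rule Liminf_mono)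
  moreover have "Liminf (at_right 0) (\<lambda>r. ereal (h r)) = ereal (- (inverse (ln 2) * ln p))"
    by (rule lim_imp_Liminf) (use h_lim in auto)
  ultimately show ?thesis by (simp add: log_def field_simps)
qed

section \<open>The Assouad spectrum\<close>

text \<open>The growth condition in the form used below. At \<open>x = R\<close> the right-hand side
  is \<open>ln (R / r)\<close>, up to rounding \<open>ln 2\<close> times the number of levels
  between the two scales, while \<open>ln \<bar>ln x\<bar>\<close> is up to a constant the logarithm
  of the level of \<open>R\<close>.\<close>

lemma dimension_function_eventually_ge:
  assumes dim: "dimension_function \<phi>"
    and lim: "((\<lambda>x. (ln \<bar>ln x\<bar> / \<bar>ln x\<bar>) / \<phi> x) \<longlongrightarrow> 0) (at_right 0)" and K: "0 < K"
  shows "\<forall>\<^sub>F x in at_right 0. K * ln \<bar>ln x\<bar> \<le> \<phi> x * \<bar>ln x\<bar>"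
proof -
  have "\<forall>\<^sub>F x in at_right 0. (ln \<bar>ln x\<bar> / \<bar>ln x\<bar>) / \<phi> x < 1 / K"
    using K by (intro order_tendstoD(2)[OF lim]) simp
  moreover have "\<forall>\<^sub>F r in at_right 0. 0 < r \<and> r < (1::real)"
    by (intro eventually_conj eventually_at_right_less eventually_at_rightI[of 0 1]) auto
  ultimately show ?thesis
  proof eventually_elim
    case (elim x)
    then have "0 < \<phi> x" "0 < \<bar>ln x\<bar>" using dim by (auto simp: dimension_function_def)
    moreover have "a / L / f < 1 / K \<Longrightarrow> K * a \<le> f * L" if "0 < f" "0 < L" for a f L :: real
      using that K by (simp add: field_simps)
    ultimately show ?case using elim(1) by blast
  qed
qed

lemma dimension_function_tendsto:
  assumes dim: "dimension_function \<phi>"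
    and lim: "((\<lambda>x. (ln \<bar>ln x\<bar> / \<bar>ln x\<bar>) / \<phi> x) \<longlongrightarrow> 0) (at_right 0)"
  shows "filterlim (\<lambda>x. \<phi> x * \<bar>ln x\<bar>) at_top (at_right 0)"
proof (rule filterlim_at_top_mono)
  show "filterlim (\<lambda>x::real. ln \<bar>ln x\<bar>) at_top (at_right 0)" by real_asymp
  show "\<forall>\<^sub>F x in at_right 0. ln \<bar>ln x\<bar> \<le> \<phi> x * \<bar>ln x\<bar>"
    using dimension_function_eventually_ge[OF dim lim, of 1] by simp
qed

text \<open>A function that tends to infinity at \<open>0\<close> cannot be increasing on
  \<open>(0, 1)\<close>, which leaves one of the two alternatives.\<close>

lemma dimension_function_antimono:
  assumes dim: "dimension_function \<phi>"
    and lim: "((\<lambda>x. (ln \<bar>ln x\<bar> / \<bar>ln x\<bar>) / \<phi> x) \<longlongrightarrow> 0) (at_right 0)"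
  shows "antimono_on {0<..<1} (\<lambda>x. \<phi> x * \<bar>ln x\<bar>)"
proof (rule ccontr)
  let ?\<psi> = "\<lambda>x. \<phi> x * \<bar>ln x\<bar>"
  assume "\<not> ?thesis"
  then have mono: "mono_on {0<..<1} ?\<psi>" using dim by (simp add: dimension_function_def)
  have "\<forall>\<^sub>F x in at_right 0. ?\<psi> (1/2) < ?\<psi> x"
    using dimension_function_tendsto[OF dim lim] by (simp only: filterlim_at_top_dense)
  moreover have "\<forall>\<^sub>F x in at_right 0. 0 < x \<and> x < (1/2::real)"
    by (intro eventually_conj eventually_at_right_less eventually_at_rightI[of 0 "1/2"]) auto
  ultimately have "\<forall>\<^sub>F x::real in at_right 0. False"
  proof eventually_elim
    case (elim x)
    then show False using mono_onD[OF mono, of x "1/2"] by simp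
  qed
  then show False by simp
qed

lemma ln_powr_dimension_function:
  assumes "0 < R" "R < (1 :: real)"
  shows "0 < R powr (1 + \<phi> R)" "- ln (R powr (1 + \<phi> R)) = - ln R + \<phi> R * \<bar>ln R\<bar>"
    "R / R powr (1 + \<phi> R) = exp (\<phi> R * \<bar>ln R\<bar>)"
proof -
  show "0 < R powr (1 + \<phi> R)" using assms by simp
  have L: "\<bar>ln R\<bar> = - ln R" using assms by simp
  show "- ln (R powr (1 + \<phi> R)) = - ln R + \<phi> R * \<bar>ln R\<bar>"
    using assms unfolding L by (simp add: ln_powr algebra_simps)
  have "R / R powr (1 + \<phi> R) = R powr (- \<phi> R)"
    using assms by (simp add: powr_add powr_minus field_simps)
  also have "\<dots> = exp (\<phi> R * \<bar>ln R\<bar>)" using assms unfolding L by (simp add: powr_def)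
  finally show "R / R powr (1 + \<phi> R) = exp (\<phi> R * \<bar>ln R\<bar>)" .
qed

text \<open>Small \<open>R\<close>: the levels \<open>k\<close> and \<open>l\<close> of the two
  scales satisfy \<open>k \<le> \<gamma> ^ (l - k)\<close>, so a ball needs at most
  \<open>b ^ (l - k)\<close> smaller ones. Large \<open>R\<close>: the smaller scale is bounded
  below, so a fixed number of balls covers the whole boundary.\<close>

lemma assouad_dim_le:
  assumes dim: "dimension_function \<phi>"
    and lim: "((\<lambda>x. (ln \<bar>ln x\<bar> / \<bar>ln x\<bar>) / \<phi> x) \<longlongrightarrow> 0) (at_right 0)"
    and b: "1 < b" and \<gamma>: "1 < \<gamma>"
    and gen: "\<forall>\<^sub>F n in sequentially. \<forall>v\<in>tree c. real (length v) \<le> \<gamma> ^ n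
           \<longrightarrow> real (generation n (shift v c)) \<le> b ^ n"
  shows "assouad_dim \<phi> (gromov_boundary (tree c)) \<le> ereal (log 2 b)"
proof -
  let ?G = "gromov_boundary (tree c)"
  define \<psi> where "\<psi> x = \<phi> x * \<bar>ln x\<bar>" for x
  have \<psi>_pos: "0 < \<psi> x" if "0 < x" "x < 1" for x
    unfolding \<psi>_def using dim that by (intro mult_pos_pos) (auto simp: dimension_function_def)
  define s where "s = log 2 b"
  have s0: "0 < s" using b by (simp add: s_def)
  obtain n0 where n0: "\<And>n v. n0 \<le> n \<Longrightarrow> v \<in> tree c \<Longrightarrow> real (length v) \<le> \<gamma> ^ n
      \<Longrightarrow> real (generation n (shift v c)) \<le> b ^ n"
    using gen unfolding eventually_sequentially by blast
  have "\<forall>\<^sub>F x in at_right 0. 2 * ln 2 / ln \<gamma> * ln \<bar>ln x\<bar> \<le> \<psi> x"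
    unfolding \<psi>_def using \<gamma> by (intro dimension_function_eventually_ge[OF dim lim]) simp
  moreover have "\<forall>\<^sub>F x in at_right 0. real n0 * ln 2 \<le> \<psi> x"
    using dimension_function_tendsto[OF dim lim] unfolding \<psi>_def by (simp only: filterlim_at_top)
  moreover have "\<forall>\<^sub>F x::real in at_right 0. 1 / ln 2 \<le> \<bar>ln x\<bar>" by real_asymp
  ultimately have "\<forall>\<^sub>F x in at_right 0. 2 * ln 2 / ln \<gamma> * ln \<bar>ln x\<bar> \<le> \<psi> x \<and> real n0 * ln 2 \<le> \<psi> x \<and> 1 / ln 2 \<le> \<bar>ln x\<bar>"
    by eventually_elim auto
  then obtain R1 where R1: "0 < R1"
    "\<And>x. 0 < x \<Longrightarrow> x < R1 \<Longrightarrow> 2 * ln 2 / ln \<gamma> * ln \<bar>ln x\<bar> \<le> \<psi> x \<and> real n0 * ln 2 \<le> \<psi> x \<and> 1 / ln 2 \<le> \<bar>ln x\<bar>"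
    unfolding eventually_at_right_field by auto
  define R0 where "R0 = min R1 (1/2)"
  have R0: "0 < R0" "R0 < 1" "R0 \<le> R1" using R1(1) by (auto simp: R0_def)
  \<comment> \<open>The level of the scale \<open>r\<close> that belongs to \<open>R0\<close>, used
    for all \<open>R \<ge> R0\<close>.\<close>
  define l1 where "l1 = nat \<lceil>(- ln R0 + \<psi> R0) / ln 2\<rceil>"
  \<comment> \<open>The factor \<open>b\<^sup>2\<close> absorbs the two levels lost by rounding
    \<open>k\<close> down and \<open>l\<close> up; the other term serves the scales
    \<open>R \<ge> R0\<close>.\<close>
  define C where "C = max (b\<^sup>2) (real (generation l1 c))"
  have C: "0 < C" using b by (simp add: C_def less_max_iff_disj)
  have bound: "ereal_of_enat (SUP x\<in>mspace ?G. covering_number ?G (R powr (1 + \<phi> R)) (mcball_of ?G x R))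
      \<le> ereal (C * (R / R powr (1 + \<phi> R)) powr s)" if R: "0 < R" "R < 1" for R
  proof -
    define r where "r = R powr (1 + \<phi> R)"
    have r: "0 < r" "- ln r = - ln R + \<psi> R" "R / r = exp (\<psi> R)"
      unfolding r_def \<psi>_def using ln_powr_dimension_function[OF R, of \<phi>] by auto
    have target: "(R / r) powr s = b powr (\<psi> R / ln 2)"
      using b by (simp add: r s_def log_def powr_def)
    have \<psi>0: "0 < \<psi> R" using \<psi>_pos R by simp
    have L0: "0 < - ln R" using R by simp
    have "\<exists>g. real g \<le> C * (R / r) powr s \<and> (\<forall>x\<in>rays (tree c). covering_number ?G r (mcball_of ?G x R) \<le> enat g)"
    proof (cases "R < R0")
      case True
      define k where "k = nat \<lfloor>- ln R / ln 2\<rfloor>"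
      define l where "l = nat \<lceil>- ln r / ln 2\<rceil>"
      have k: "R \<le> 2 powr - real k" "- ln R / ln 2 - 1 \<le> real k"
        unfolding k_def using two_powr_floor[of R] R by auto
      have "0 \<le> - ln R / ln 2" using L0 by (intro divide_nonneg_pos) auto
      then have k': "real k \<le> - ln R / ln 2" unfolding k_def by linarith
      have "0 \<le> - ln r / ln 2" using r \<psi>0 L0 by (intro divide_nonneg_pos) auto
      then have l: "- ln r / ln 2 \<le> real l" "real l \<le> - ln r / ln 2 + 1"
        unfolding l_def by linarith+
      define n where "n = l - k"
      have eq: "- ln r / ln 2 = - ln R / ln 2 + \<psi> R / ln 2" unfolding r(2) by (rule add_divide_distrib)
      have pos: "0 < \<psi> R / ln 2" using \<psi>0 by simp
      have kl: "k \<le> l" using k' l(1) eq pos by linarith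
      have n: "\<psi> R / ln 2 \<le> real n" "real n \<le> \<psi> R / ln 2 + 2"
        using kl k k' l eq by (auto simp: n_def of_nat_diff)
      have R1': "2 * ln 2 / ln \<gamma> * ln \<bar>ln R\<bar> \<le> \<psi> R" "real n0 * ln 2 \<le> \<psi> R" "1 / ln 2 \<le> - ln R"
        using R1(2)[of R] R R0 True L0 by auto
      have "real n0 \<le> \<psi> R / ln 2" using R1'(2) by (simp add: field_simps)
      then have n0n: "n0 \<le> n" using n(1) by linarith
      have "real k \<le> \<gamma> ^ n"
      proof -
        have "real k \<le> (- ln R) * (1 / ln 2)" using k' by simp
        also have "\<dots> \<le> (- ln R) * (- ln R)" using R1'(3) L0 by (intro mult_left_mono) auto
        also have "\<dots> = exp (2 * ln (- ln R))" using L0 by (simp add: exp_double power2_eq_square)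
        \<comment> \<open>The factor \<open>2 * ln 2 / ln \<gamma>\<close> in the growth condition
          was chosen for this step: it puts the square of \<open>ln R\<close> below
          \<open>\<gamma> ^ n\<close>.\<close>
        also have "\<dots> \<le> exp (\<psi> R / ln 2 * ln \<gamma>)"
        proof -
          have "2 * ln \<bar>ln R\<bar> = 2 * ln 2 / ln \<gamma> * ln \<bar>ln R\<bar> * (ln \<gamma> / ln 2)" using \<gamma> by simp
          also have "\<dots> \<le> \<psi> R * (ln \<gamma> / ln 2)" using R1'(1) \<gamma> by (intro mult_right_mono) auto
          finally show ?thesis using L0 by simp
        qed
        also have "\<dots> \<le> exp (real n * ln \<gamma>)" unfolding exp_le_cancel_iff using n(1) \<gamma> by (intro mult_right_mono) auto
        also have "\<dots> = \<gamma> ^ n" using \<gamma> by (simp add: exp_of_nat_mult)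
        finally show ?thesis .
      qed
      then have "real (generation n (shift (x k) c)) \<le> b ^ n" if "x \<in> rays (tree c)" for x
        using n0[OF n0n ray_in_tree[OF that, of k]] ray_length[OF that, of k] by simp
      then have g: "generation n (shift (x k) c) \<le> nat \<lfloor>b ^ n\<rfloor>" if "x \<in> rays (tree c)" for x
        using that by (simp add: le_nat_floor)
      show ?thesis
      proof (intro exI conjI ballI)
        have "real (nat \<lfloor>b ^ n\<rfloor>) \<le> b ^ n" using b by simp
        also have "\<dots> = b powr real n" using b by (simp add: powr_realpow)
        also have "\<dots> \<le> b powr (\<psi> R / ln 2 + 2)" using n(2) b by (intro powr_mono) auto
        also have "\<dots> = b\<^sup>2 * (R / r) powr s" using b by (simp add: target powr_add)
        also have "\<dots> \<le> C * (R / r) powr s" by (intro mult_right_mono) (auto simp: C_def)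
        finally show "real (nat \<lfloor>b ^ n\<rfloor>) \<le> C * (R / r) powr s" .
        fix x assume x: "x \<in> rays (tree c)"
        have "covering_number ?G r (mcball_of ?G x R) \<le> enat (generation (l - k) (shift (x k) c))"
          by (rule covering_number_ball_le[OF r(1) two_powr_ceiling[OF r(1) l(1)] kl k(1) x])
        also have "\<dots> \<le> enat (nat \<lfloor>b ^ n\<rfloor>)" using g[OF x] by (simp add: n_def)
        finally show "covering_number ?G r (mcball_of ?G x R) \<le> enat (nat \<lfloor>b ^ n\<rfloor>)" .
      qed
    next
      case False
      \<comment> \<open>Since \<open>\<psi>\<close> is decreasing, the scale \<open>r\<close> of any
        \<open>R \<ge> R0\<close> is at least that of \<open>R0\<close>.\<close>
      have "\<psi> R \<le> \<psi> R0"
        using monotone_onD[OF dimension_function_antimono[OF dim lim], of R0 R] False R R0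
        by (simp add: \<psi>_def)
      moreover have "- ln R \<le> - ln R0" using False R R0 by simp
      ultimately have "- ln r / ln 2 \<le> (- ln R0 + \<psi> R0) / ln 2"
        unfolding r(2) by (intro divide_right_mono) auto
      also have "\<dots> \<le> real l1" unfolding l1_def by linarith
      finally have l1: "2 powr - real l1 \<le> r" by (rule two_powr_ceiling[OF r(1)])
      show ?thesis
      proof (intro exI conjI ballI)
        have "real (generation l1 c) * 1 \<le> C * (R / r) powr s"
          using C \<psi>0 b by (intro mult_mono) (auto simp: C_def target intro!: ge_one_powr_ge_zero)
        then show "real (generation l1 c) \<le> C * (R / r) powr s" by simp
        show "covering_number ?G r (mcball_of ?G x R) \<le> enat (generation l1 c)" for x
          by (rule covering_number_rays_le[OF r(1) l1]) auto
      qed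
    qed
    then obtain g where g: "real g \<le> C * (R / r) powr s"
      "\<And>x. x \<in> rays (tree c) \<Longrightarrow> covering_number ?G r (mcball_of ?G x R) \<le> enat g" by blast
    have "(SUP x\<in>mspace ?G. covering_number ?G r (mcball_of ?G x R)) \<le> enat g"
      using g(2) by (intro SUP_least) simp
    then have "ereal_of_enat (SUP x\<in>mspace ?G. covering_number ?G r (mcball_of ?G x R)) \<le> ereal_of_enat (enat g)"
      by (simp only: ereal_of_enat_le_iff)
    also have "\<dots> \<le> ereal (C * (R / r) powr s)" using g(1) by simp
    finally show ?thesis unfolding r_def .
  qed
  show ?thesis
    unfolding assouad_dim_def s_def[symmetric]
    using C bound by (intro INF_lower) (auto simp: Let_def)
qed

text \<open>Iterating \<open>R \<mapsto> R powr (1 + \<phi> R)\<close> takes \<open>o(- ln R)\<close> steps to reach scale \<open>R\<close>, so the constant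
  in the definition of the Assouad spectrum does not affect the exponent of the whole space.\<close>

lemma assouad_dim_ge:
  assumes dim: "dimension_function \<phi>"
    and lim: "((\<lambda>x. (ln \<bar>ln x\<bar> / \<bar>ln x\<bar>) / \<phi> x) \<longlongrightarrow> 0) (at_right 0)"
    and p: "0 < p" "p < 1" and q1: "cut_prob_lim p c < 1"
  shows "ereal (- log 2 p) \<le> assouad_dim \<phi> (gromov_boundary (tree c))"
  unfolding assouad_dim_def Let_def
proof (rule INF_greatest, rule ccontr)
  let ?G = "gromov_boundary (tree c)"
  define \<psi> where "\<psi> x = \<phi> x * \<bar>ln x\<bar>" for x
  define t where "t = - log 2 p"
  fix s assume "s \<in> {s. \<exists>C>0. \<forall>R. 0 < R \<and> R < 1 \<longrightarrow>
      ereal_of_enat (SUP x\<in>mspace ?G. covering_number ?G (R powr (1 + \<phi> R)) (mcball_of ?G x R))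
      \<le> ereal (C * (R / R powr (1 + \<phi> R)) powr s)}" and "\<not> ereal (- log 2 p) \<le> ereal s"
  then obtain C where C: "0 < C" "\<And>R. 0 < R \<Longrightarrow> R < 1 \<Longrightarrow>
      ereal_of_enat (SUP x\<in>mspace ?G. covering_number ?G (R powr (1 + \<phi> R)) (mcball_of ?G x R))
      \<le> ereal (C * (R / R powr (1 + \<phi> R)) powr s)" and st: "s < t" by (auto simp: t_def)
  define q where "q = 1 - cut_prob_lim p c"
  have q0: "0 < q" using q1 by (simp add: q_def)
  have t: "0 < t" using p by (simp add: t_def)
  \<comment> \<open>Each iteration may lose a factor \<open>C\<close>. If \<open>- ln R\<close>
    grows by at least \<open>K\<close> per step, the gap \<open>t - s\<close> between the exponents
    gains \<open>\<bar>ln C\<bar> + 1\<close>, which outweighs the loss by at least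
    \<open>1\<close>.\<close>
  define K where "K = (\<bar>ln C\<bar> + 1) / (t - s)"
  have K: "0 < K" using st by (auto simp: K_def intro!: divide_pos_pos)
  have "\<forall>\<^sub>F x in at_right 0. K \<le> \<psi> x"
    using dimension_function_tendsto[OF dim lim] unfolding \<psi>_def by (simp only: filterlim_at_top)
  then obtain R1 where R1: "0 < R1" "\<And>x. 0 < x \<Longrightarrow> x < R1 \<Longrightarrow> K \<le> \<psi> x"
    unfolding eventually_at_right_field by auto
  define R0 where "R0 = min (R1 / 2) (1/2)"
  have R0: "0 < R0" "R0 < R1" "R0 < 1" using R1(1) by (auto simp: R0_def min_def)
  \<comment> \<open>Each scale is the smaller scale belonging to the one before. All stay below
    \<open>R1\<close>, so \<open>K \<le> \<psi> (R i)\<close> throughout.\<close>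
  define R where "R i = ((\<lambda>x. x powr (1 + \<phi> x)) ^^ i) R0" for i
  have R_0: "R 0 = R0" and R_Suc: "R (Suc i) = R i powr (1 + \<phi> (R i))" for i
    by (simp_all add: R_def)
  have R: "0 < R i \<and> R i \<le> R0 \<and> - ln R0 + real i * K \<le> - ln (R i)" for i
  proof (induction i)
    case (Suc i)
    then have i: "0 < R i" "R i < 1" "R i < R1" using R0 by auto
    note P = ln_powr_dimension_function[OF i(1,2), of \<phi>, folded R_Suc \<psi>_def]
    have "- ln R0 + real (Suc i) * K \<le> - ln (R (Suc i))"
      using P(2) Suc R1(2)[OF i(1) i(3)] by (simp add: algebra_simps)
    moreover have "R (Suc i) \<le> R0"
    proof -
      have "0 \<le> real (Suc i) * K" using K by simp
      then have "ln (R (Suc i)) \<le> ln R0" using calculation by linarith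
      then show ?thesis using P(1) R0 by simp
    qed
    ultimately show ?case using P(1) by simp
  qed (use R0 in \<open>simp add: R_0\<close>)
  define A where "A = real (generation (nat \<lceil>- ln R0 / ln 2\<rceil>) c)"
  \<comment> \<open>Refining cover by cover, the ratios telescope to
    \<open>(R0 / R i) powr s\<close>, and each step contributes one factor \<open>C\<close>.\<close>
  have cov: "\<exists>k. covering_number ?G (R i) (rays (tree c)) \<le> enat k
      \<and> real k \<le> A * C ^ i * exp (s * (- ln (R i) + ln R0))" for i
  proof (induction i)
    case 0
    have "covering_number ?G R0 (rays (tree c)) \<le> enat (generation (nat \<lceil>- ln R0 / ln 2\<rceil>) c)"
      by (rule covering_number_rays_le[OF R0(1) two_powr_ceiling[OF R0(1) real_nat_ceiling_ge] order_refl])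
    then show ?case by (auto simp: R_0 A_def)
  next
    case (Suc i)
    then obtain k where k: "covering_number ?G (R i) (rays (tree c)) \<le> enat k"
      "real k \<le> A * C ^ i * exp (s * (- ln (R i) + ln R0))" by blast
    have i: "0 < R i" "R i < 1" using R[of i] R0 by auto
    note P = ln_powr_dimension_function[OF i, of \<phi>, folded R_Suc \<psi>_def]
    let ?S = "SUP x\<in>mspace ?G. covering_number ?G (R (Suc i)) (mcball_of ?G x (R i))"
    have S: "ereal_of_enat ?S \<le> ereal (C * exp (s * \<psi> (R i)))"
      using C(2)[OF i, folded R_Suc] by (simp add: P(3) powr_def)
    then obtain j where j: "?S = enat j" "real j \<le> C * exp (s * \<psi> (R i))"
      by (cases ?S) auto
    have "covering_number ?G (R (Suc i)) (rays (tree c)) \<le> enat (k * j)"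
    proof (rule covering_number_mult[OF k(1)])
      show "covering_number ?G (R (Suc i)) (mcball_of ?G x (R i)) \<le> enat j" if "x \<in> mspace ?G" for x
        unfolding j(1)[symmetric] using that by (rule SUP_upper)
    qed
    moreover have "real (k * j) \<le> A * C ^ Suc i * exp (s * (- ln (R (Suc i)) + ln R0))"
    proof -
      have "real (k * j) \<le> (A * C ^ i * exp (s * (- ln (R i) + ln R0))) * (C * exp (s * \<psi> (R i)))"
        unfolding of_nat_mult using k(2) j(2) C(1) by (intro mult_mono) (auto simp: A_def)
      also have "\<dots> = A * C ^ Suc i * exp (s * (- ln (R (Suc i)) + ln R0))"
        unfolding P(2) by (simp add: algebra_simps exp_add[symmetric])
      finally show ?thesis .
    qed
    ultimately show ?case by blast
  qed
  \<comment> \<open>Comparison with the lower bound \<open>q / p ^ n\<close> at scale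
    \<open>R i\<close>: \<open>(t - s) * y\<close> is at most a constant plus
    \<open>i * ln C\<close>, while \<open>y \<ge> - ln R0 + i * K\<close>. The choice of
    \<open>K\<close> then bounds \<open>i\<close>.\<close>
  have key: "real i \<le> ln A + s * ln R0 - ln q + t * ln 2 + (t - s) * ln R0" for i
  proof -
    define y where "y = - ln (R i)"
    have Ri: "0 < R i" "R i \<le> 1" "- ln R0 + real i * K \<le> y" using R[of i] R0 by (auto simp: y_def)
    define n where "n = nat \<lfloor>- ln (R i) / ln 2\<rfloor>"
    have n: "R i \<le> 2 powr - real n" "y / ln 2 - 1 \<le> real n"
      unfolding n_def y_def using two_powr_floor[OF Ri(1,2)] by auto
    obtain k where k: "covering_number ?G (R i) (rays (tree c)) \<le> enat k"
      "real k \<le> A * C ^ i * exp (s * (y + ln R0))" using cov[of i] by (auto simp: y_def)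
    have "q \<le> real k * p ^ n" unfolding q_def by (rule covering_number_ge[OF p n(1) k(1)])
    also have "\<dots> \<le> A * C ^ i * exp (s * (y + ln R0)) * p ^ n"
      using k(2) p by (intro mult_right_mono) auto
    finally have le: "q \<le> A * C ^ i * exp (s * (y + ln R0)) * p ^ n" .
    then have A: "0 < A" using q0 by (cases "A = 0") (auto simp: A_def)
    have "ln q \<le> ln (A * C ^ i * exp (s * (y + ln R0)) * p ^ n)" using le q0 by simp
    also have "\<dots> = ln A + real i * ln C + s * (y + ln R0) + real n * ln p"
      using A C(1) p by (simp add: ln_mult ln_realpow)
    also have "real n * ln p \<le> (y / ln 2 - 1) * ln p"
      using n(2) p by (intro mult_right_mono_neg) auto
    also have "\<dots> = - t * (y - ln 2)" by (simp add: t_def log_def field_simps)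
    finally have 1: "ln q \<le> ln A + real i * ln C + s * (y + ln R0) - t * (y - ln 2)" by simp
    have "(t - s) * (- ln R0 + real i * K) \<le> (t - s) * y"
      using Ri(3) st by (intro mult_left_mono) auto
    moreover have "(t - s) * (real i * K) = real i * (\<bar>ln C\<bar> + 1)" using st by (simp add: K_def)
    moreover have "real i * ln C \<le> real i * \<bar>ln C\<bar>" by (intro mult_left_mono) auto
    ultimately show ?thesis using 1 by (simp add: algebra_simps)
  qed
  obtain i where "ln A + s * ln R0 - ln q + t * ln 2 + (t - s) * ln R0 < real i"
    using reals_Archimedean2 by blast
  with key[of i] show False by simp
qed

section \<open>Almost sure values of the dimensions\<close>

context supercritical
begin

text \<open>The null sets depend on \<open>b\<close> and \<open>p\<close>; rational values keep them
  countable in number, and \<open>b\<close> can be taken close to \<open>m\<close>, \<open>p\<close>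
  close to \<open>1 / m\<close>.\<close>

lemma AE_dims:
  assumes dim: "dimension_function \<phi>"
    and lim: "((\<lambda>x. (ln \<bar>ln x\<bar> / \<bar>ln x\<bar>) / \<phi> x) \<longlongrightarrow> 0) (at_right 0)"
  shows "AE c in gw \<theta>. infinite (tree c) \<longrightarrow>
           has_box_dim (gromov_boundary (tree c)) (ereal (log 2 m)) \<and>
           assouad_dim \<phi> (gromov_boundary (tree c)) = ereal (log 2 m) \<and>
           hausdorff_dim (gromov_boundary (tree c)) = ereal (log 2 m)"
proof -
  have "AE c in gw \<theta>. \<forall>b\<in>\<rat>. m < b \<longrightarrow> (\<exists>\<gamma>>1. \<forall>\<^sub>F n in sequentially. \<forall>v\<in>tree c.
          real (length v) \<le> \<gamma> ^ n \<longrightarrow> real (generation n (shift v c)) \<le> b ^ n)"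
    using AE_generation_le by (subst AE_ball_countable) (auto simp: countable_rat)
  moreover have "AE c in gw \<theta>. \<forall>p\<in>\<rat>. 1 / m < p \<and> p < 1 \<longrightarrow> infinite (tree c) \<longrightarrow> cut_prob_lim p c < 1"
    using AE_cut_prob_lim_less_1 by (subst AE_ball_countable) (auto simp: countable_rat)
  ultimately show ?thesis
  proof eventually_elim
    case (elim c)
    show ?case
    proof
      let ?G = "gromov_boundary (tree c)"
      assume inf: "infinite (tree c)"
      have upper: "x \<le> ereal (log 2 m)" if x: "\<And>b. b \<in> \<rat> \<Longrightarrow> m < b \<Longrightarrow> x \<le> ereal (log 2 b)" for x
      proof (rule ereal_le_epsilon2)
        fix e :: real assume e: "0 < e"
        have "m = 2 powr log 2 m" using m_gt_1 by simp
        also have "\<dots> < 2 powr (log 2 m + e)" using e by (intro powr_less_mono) auto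
        finally obtain b where b: "b \<in> \<rat>" "m < b" "b < 2 powr (log 2 m + e)" using Rats_dense_in_real by blast
        have "log 2 b \<le> log 2 m + e" using b m_gt_1 by (subst log_le_iff) auto
        then show "x \<le> ereal (log 2 m) + ereal e" using x[OF b(1,2)] by (auto intro: order_trans)
      qed
      have lower: "ereal (log 2 m) \<le> x" if x: "\<And>p. p \<in> \<rat> \<Longrightarrow> 1 / m < p \<Longrightarrow> p < 1 \<Longrightarrow> ereal (- log 2 p) \<le> x" for x
      proof (rule ereal_le_epsilon2)
        fix e :: real assume e: "0 < e"
        have "1 / m = 2 powr (- log 2 m)" using m_gt_1 by (simp add: powr_minus_divide)
        also have "\<dots> < 2 powr (- log 2 m + e)" using e by (intro powr_less_mono) auto
        finally have "1 / m < min 1 (2 powr (- log 2 m + e))" using m_gt_1 by simp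
        then obtain p where p: "p \<in> \<rat>" "1 / m < p" "p < min 1 (2 powr (- log 2 m + e))"
          using Rats_dense_in_real by blast
        have "0 < p" using p(2) m_gt_1 by (smt (verit) divide_pos_pos)
        then have "log 2 p \<le> - log 2 m + e" using p by (subst log_le_iff) auto
        then have "ereal (log 2 m) \<le> ereal (- log 2 p) + ereal e" by simp
        also have "\<dots> \<le> x + ereal e" using x[OF p(1,2)] p(3) by (intro add_right_mono) simp
        finally show "ereal (log 2 m) \<le> x + ereal e" .
      qed
      have p: "0 < p" if "1 / m < p" for p using that m_gt_1 by (smt (verit) divide_pos_pos)
      have gen: "\<forall>\<^sub>F n in sequentially. real (generation n c) \<le> b ^ n" if b: "b \<in> \<rat>" "m < b" for b
      proof -
        obtain \<gamma> where \<gamma>: "1 < \<gamma>" "\<forall>\<^sub>F n in sequentially. \<forall>v\<in>tree c.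
          real (length v) \<le> \<gamma> ^ n \<longrightarrow> real (generation n (shift v c)) \<le> b ^ n" using elim(1) b by blast
        from \<gamma>(2) show ?thesis
        proof eventually_elim
          case (elim n)
          \<comment> \<open>The root has level \<open>0\<close>, so the uniform bound contains the
            growth of whole generations.\<close>
          from elim[rule_format, of "[]"] \<gamma>(1) show ?case by simp
        qed
      qed
      have "upper_box_dim ?G \<le> ereal (log 2 m)"
        using gen m_gt_1 by (intro upper upper_box_dim_le) auto
      moreover have "ereal (log 2 m) \<le> lower_box_dim ?G"
        using elim(2) inf p by (intro lower lower_box_dim_ge) auto
      moreover have "lower_box_dim ?G \<le> upper_box_dim ?G"
        unfolding lower_box_dim_def upper_box_dim_def by (rule Liminf_le_Limsup) simp
      moreover have "hausdorff_dim ?G \<le> ereal (log 2 m)"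
        using gen m_gt_1 by (intro upper hausdorff_dim_le) auto
      moreover have "ereal (log 2 m) \<le> hausdorff_dim ?G"
        using elim(2) inf p by (intro lower hausdorff_dim_ge) auto
      moreover have "assouad_dim \<phi> ?G \<le> ereal (log 2 m)"
      proof (rule upper)
        fix b assume b: "b \<in> \<rat>" "m < b"
        then obtain \<gamma> where \<gamma>: "1 < \<gamma>" "\<forall>\<^sub>F n in sequentially. \<forall>v\<in>tree c.
          real (length v) \<le> \<gamma> ^ n \<longrightarrow> real (generation n (shift v c)) \<le> b ^ n" using elim(1) by blast
        show "assouad_dim \<phi> ?G \<le> ereal (log 2 b)"
          using b m_gt_1 by (intro assouad_dim_le[OF dim lim _ \<gamma>]) auto
      qed
      moreover have "ereal (log 2 m) \<le> assouad_dim \<phi> ?G"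
        using elim(2) inf p by (intro lower assouad_dim_ge[OF dim lim]) auto
      ultimately show "has_box_dim ?G (ereal (log 2 m)) \<and> assouad_dim \<phi> ?G = ereal (log 2 m)
          \<and> hausdorff_dim ?G = ereal (log 2 m)"
        unfolding has_box_dim_def by (meson order_antisym order_trans)
    qed
  qed
qed

end

theorem corollary2p2:
  fixes M :: "'w measure" and \<xi> :: "nat list \<Rightarrow> 'w \<Rightarrow> nat"
    and \<theta> :: "nat pmf" and N :: nat and \<phi> :: "real \<Rightarrow> real"
  defines "\<tau> \<equiv> \<lambda>\<omega>. tree (\<lambda>v. \<xi> v \<omega>)"
  assumes "prob_space M"
    and "prob_space.indep_vars M (\<lambda>_. count_space UNIV) \<xi> UNIV"
    and "\<And>v. distr M (count_space UNIV) (\<xi> v) = measure_pmf \<theta>"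
    and "set_pmf \<theta> \<subseteq> {0..N}"
    and "measure_pmf.expectation \<theta> real > 1"
    and "dimension_function \<phi>"
    and "((\<lambda>x. (ln \<bar>ln x\<bar> / \<bar>ln x\<bar>) / \<phi> x) \<longlongrightarrow> 0) (at_right 0)"
  shows "AE \<omega> in uniform_measure M {\<omega> \<in> space M. infinite (\<tau> \<omega>)}.
           has_box_dim (gromov_boundary (\<tau> \<omega>)) (assouad_dim \<phi> (gromov_boundary (\<tau> \<omega>))) \<and>
           assouad_dim \<phi> (gromov_boundary (\<tau> \<omega>)) = hausdorff_dim (gromov_boundary (\<tau> \<omega>))"
proof (rule AE_uniform_measureI)
  interpret prob_space M by fact
  interpret supercritical \<theta> N "measure_pmf.expectation \<theta> real"
    by unfold_locales (use assms in auto)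
  \<comment> \<open>The tree is a function of the whole family \<open>\<xi>\<close>, so only the
    joint law matters; independence and the common marginal identify it as
    \<open>gw \<theta>\<close>.\<close>
  define X where "X \<omega> = (\<lambda>v. \<xi> v \<omega>)" for \<omega>
  have \<xi>: "\<xi> v \<in> M \<rightarrow>\<^sub>M count_space UNIV" for v
    using assms(3) unfolding indep_vars_def by simp
  have "distr M (PiM UNIV (\<lambda>_. count_space UNIV)) (\<lambda>\<omega>. \<lambda>v\<in>UNIV. \<xi> v \<omega>)
      = PiM UNIV (\<lambda>v. distr M (count_space UNIV) (\<xi> v))"
    using assms(3) \<xi> by (subst (asm) indep_vars_iff_distr_eq_PiM') auto
  then have "distr M (PiM UNIV (\<lambda>_. count_space UNIV)) X = gw \<theta>"
    by (simp add: assms(4) gw_def X_def[abs_def] restrict_def)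
  moreover have "distr M (gw \<theta>) X = distr M (PiM UNIV (\<lambda>_. count_space UNIV)) X"
    by (intro distr_cong) (auto simp: sets_gw)
  ultimately have distr: "distr M (gw \<theta>) X = gw \<theta>" by simp
  have X [measurable]: "X \<in> M \<rightarrow>\<^sub>M gw \<theta>"
    unfolding X_def gw_def using \<xi> by (intro measurable_PiM_single') (auto simp: space_PiM)
  have "{\<omega> \<in> space M. infinite (tree (X \<omega>))} = space M - (X -` {c. finite (tree c)} \<inter> space M)" by auto
  then show "{\<omega> \<in> space M. infinite (\<tau> \<omega>)} \<in> sets M"
    unfolding \<tau>_def X_def[symmetric] using measurable_sets[OF X sets_finite_tree] by auto
  have "AE c in distr M (gw \<theta>) X. infinite (tree c) \<longrightarrow>
           has_box_dim (gromov_boundary (tree c)) (assouad_dim \<phi> (gromov_boundary (tree c))) \<and>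
           assouad_dim \<phi> (gromov_boundary (tree c)) = hausdorff_dim (gromov_boundary (tree c))"
    unfolding distr using AE_dims[OF assms(7,8)] by eventually_elim auto
  from AE_distrD[OF X this]
  show "AE \<omega> in M. \<omega> \<in> {\<omega> \<in> space M. infinite (\<tau> \<omega>)} \<longrightarrow>
           has_box_dim (gromov_boundary (\<tau> \<omega>)) (assouad_dim \<phi> (gromov_boundary (\<tau> \<omega>))) \<and>
           assouad_dim \<phi> (gromov_boundary (\<tau> \<omega>)) = hausdorff_dim (gromov_boundary (\<tau> \<omega>))"
    unfolding \<tau>_def X_def by eventually_elim auto
qed

end
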